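(* Let $H$ be a subgroup of a finite group $G$ and let $\alpha\in Z^3(G,k^* )$ be a normalised 3-cocycle. An indecomposable separable algebra $B$ in $\mathcal{Z}(H,\alpha|_H)$ with $B_e=k$ has the form $k[F,\gamma]$, for a normal subgroup $F\vartriangleleft H$ and a cochain $\gamma\in C^2(F,k^* )$ with $d(\gamma)=\alpha|_F$, with the $\alpha$-projective $H$-action given by $$h.e_f=\varepsilon_h(f)\,e_{hfh^{-1}},\qquad h\in H,\ f\in F,$$ for some $\varepsilon:H\times F\to k^*$ satisfying $$\varepsilon_{gh}(f)=\varepsilon_g(hfh^{-1})\,\varepsilon_h(f)\,\alpha(g,h|f),\qquad g,h\in H,\ f\in F,$$ $$\gamma(f,g)\,\varepsilon_h(fg)=\alpha(h|f,g)\,\varepsilon_h(f)\,\varepsilon_h(g)\,\gamma(hfh^{-1},hgh^{-1}),\qquad h\in H,\ f,g\in F.$$ The algebra $k[F,\gamma]$ (with this action) is commutative (and hence etale) if $$\gamma(f,g)=\varepsilon_f(g)\,\gamma(fgf^{-1},f),\qquad f,g\in F.$$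
   Context: $k$ is an algebraically closed field of characteristic zero, $k^*$ its multiplicative group; vector spaces are finite dimensional. Normalised 3-cocycles of $G$ are functions $\alpha:G^3\to k^*$ with $\alpha(g,h,l)\alpha(f,gh,l)\alpha(f,g,h)=\alpha(fg,h,l)\alpha(f,g,hl)$ and $\alpha(f,g,h)=1$ whenever one of $f,g,h$ is the identity $e$. With ${}^{g}h=ghg^{-1}$ put $$\alpha(f,g|h)=\alpha(f,g,h)^{-1}\alpha(f,{}^{g}h,g)\alpha({}^{fg}h,f,g)^{-1},\qquad \alpha(f|g,h)=\alpha(f,g,h)\alpha({}^{f}g,f,h)^{-1}\alpha({}^{f}g,{}^{f}h,f).$$ The braided monoidal category $\mathcal{Z}(G,\alpha)$ (and likewise $\mathcal{Z}(H,\alpha|_H)$): objects are $G$-graded vector spaces $X=\bigoplus_gX_g$ with an $\alpha$-projective $G$-action, i.e. automorphisms $v\mapsto f.v$ with $f.X_g=X_{fgf^{-1}}$ and $(fg).v=\alpha(f,g|h)\,f.(g.v)$ for $v\in X_h$; morphisms preserve grading and action. Tensor product: graded tensor product with $f.(x\otimes y)=\alpha(f|g,h)(f.x\otimes f.y)$ for $x\in X_g,y\in Y_h$; associativity constraint $u\otimes(v\otimes w)\mapsto\alpha(f,g,h)(u\otimes v)\otimes w$ for degrees $f,g,h$; unit $k$ in degree $e$; braiding $c_{X,Y}(x\otimes y)=f.y\otimes x$ for $x\in X_f$. "Algebra" means associative unital algebra object; $A$ is commutative if $\mu=\mu\circ c_{A,A}$; indecomposable means not a direct sum of two nonzero algebras.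 For an algebra $A$ in this category the canonical trace function $\tau:A\to k$ is zero on $A_f$ for $f\neq e$ and equals the trace of the linear map $x\mapsto ax$ on $A$ for $a\in A_e$; $A$ is separable if the pairing $a\otimes b\mapsto\tau(ab)$ is nondegenerate. Etale means indecomposable, commutative and separable. $C^2(F,k^* )$ is the group of normalised 2-cochains $F\times F\to k^*$; $d(\gamma)(f,g,h)=\gamma(g,h)\gamma(fg,h)^{-1}\gamma(f,gh)\gamma(f,g)^{-1}$. For $d(\gamma)=\alpha|_F$, $k[F,\gamma]$ is the $H$-graded algebra with basis $e_f$, $f\in F$, of degree $|e_f|=f$ and multiplication $e_fe_g=\gamma(f,g)e_{fg}$; it satisfies $a(bc)=\alpha(f,g,h)(ab)c$ for $a,b,c$ of degrees $f,g,h$. "Has the form" means "is isomorphic to an algebra of this form". *)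

theory Defs
  imports
    "HOL-Algebra.Coset"
    "HOL-Computational_Algebra.Polynomial"
    "HOL-Library.Function_Algebras"
    "HOL-Library.Product_Plus"
    "HOL-Library.FuncSet"
begin

section \<open>Cochains\<close>

text \<open>
  Cochains with values in the multiplicative group of the field are total functions of which only
  the (non-zero) values on the carrier of the group matter.  Consequently the restriction of a
  cocycle \<open>\<alpha>\<close> to a subgroup \<open>H\<close> is \<open>\<alpha>\<close> itself, used together with the group
  \<open>G\<lparr>carrier := H\<rparr>\<close>.
\<close>

definition conjg :: "('g, 'm) monoid_scheme \<Rightarrow> 'g \<Rightarrow> 'g \<Rightarrow> 'g" where
  "conjg G g h = g \<otimes>\<^bsub>G\<^esub> h \<otimes>\<^bsub>G\<^esub> inv\<^bsub>G\<^esub> g"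

definition normalised_3cocycle ::
  "('g, 'm) monoid_scheme \<Rightarrow> ('g \<Rightarrow> 'g \<Rightarrow> 'g \<Rightarrow> 'k::field) \<Rightarrow> bool" where
  "normalised_3cocycle G \<alpha> \<longleftrightarrow>
     (\<forall>f\<in>carrier G. \<forall>g\<in>carrier G. \<forall>h\<in>carrier G. \<alpha> f g h \<noteq> 0) \<and>
     (\<forall>f\<in>carrier G. \<forall>g\<in>carrier G. \<forall>h\<in>carrier G. \<forall>l\<in>carrier G.
        \<alpha> g h l * \<alpha> f (g \<otimes>\<^bsub>G\<^esub> h) l * \<alpha> f g h
          = \<alpha> (f \<otimes>\<^bsub>G\<^esub> g) h l * \<alpha> f g (h \<otimes>\<^bsub>G\<^esub> l)) \<and>
     (\<forall>f\<in>carrier G. \<forall>g\<in>carrier G. \<forall>h\<in>carrier G.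
        f = \<one>\<^bsub>G\<^esub> \<or> g = \<one>\<^bsub>G\<^esub> \<or> h = \<one>\<^bsub>G\<^esub> \<longrightarrow> \<alpha> f g h = 1)"

definition normalised_2cochain ::
  "('g, 'm) monoid_scheme \<Rightarrow> ('g \<Rightarrow> 'g \<Rightarrow> 'k::field) \<Rightarrow> bool" where
  "normalised_2cochain F \<gamma> \<longleftrightarrow>
     (\<forall>f\<in>carrier F. \<forall>g\<in>carrier F. \<gamma> f g \<noteq> 0) \<and>
     (\<forall>f\<in>carrier F. \<gamma> \<one>\<^bsub>F\<^esub> f = 1 \<and> \<gamma> f \<one>\<^bsub>F\<^esub> = 1)"

definition coboundary2 ::
  "('g, 'm) monoid_scheme \<Rightarrow> ('g \<Rightarrow> 'g \<Rightarrow> 'k::field) \<Rightarrow> 'g \<Rightarrow> 'g \<Rightarrow> 'g \<Rightarrow> 'k" where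
  "coboundary2 F \<gamma> f g h =
     \<gamma> g h * inverse (\<gamma> (f \<otimes>\<^bsub>F\<^esub> g) h) * \<gamma> f (g \<otimes>\<^bsub>F\<^esub> h) * inverse (\<gamma> f g)"

text \<open>\<open>act_cocycle G \<alpha> f g h\<close> is \<open>\<alpha>(f, g | h)\<close> and \<open>tensor_cocycle G \<alpha> f g h\<close> is
  \<open>\<alpha>(f | g, h)\<close>.\<close>

definition act_cocycle ::
  "('g, 'm) monoid_scheme \<Rightarrow> ('g \<Rightarrow> 'g \<Rightarrow> 'g \<Rightarrow> 'k::field) \<Rightarrow> 'g \<Rightarrow> 'g \<Rightarrow> 'g \<Rightarrow> 'k" where
  "act_cocycle G \<alpha> f g h =
     inverse (\<alpha> f g h) * \<alpha> f (conjg G g h) g * inverse (\<alpha> (conjg G (f \<otimes>\<^bsub>G\<^esub> g) h) f g)"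

definition tensor_cocycle ::
  "('g, 'm) monoid_scheme \<Rightarrow> ('g \<Rightarrow> 'g \<Rightarrow> 'g \<Rightarrow> 'k::field) \<Rightarrow> 'g \<Rightarrow> 'g \<Rightarrow> 'g \<Rightarrow> 'k" where
  "tensor_cocycle G \<alpha> f g h =
     \<alpha> f g h * inverse (\<alpha> (conjg G f g) f h) * \<alpha> (conjg G f g) (conjg G f h) f"


section \<open>The category \<open>Z(G, \<alpha>)\<close>\<close>

text \<open>
  The underlying vector space of an object is a subspace \<open>vec X\<close> of a type carrying a vector
  space structure \<open>scl X\<close>; \<open>homog X g\<close> is the homogeneous component of degree \<open>g\<close>.
\<close>

record ('g, 'k, 'b) zobj =
  vec :: "'b set"
  scl :: "'k \<Rightarrow> 'b \<Rightarrow> 'b"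
  homog :: "'g \<Rightarrow> 'b set"
  act :: "'g \<Rightarrow> 'b \<Rightarrow> 'b"

definition fin_dim_space :: "('k::field \<Rightarrow> 'b::ab_group_add \<Rightarrow> 'b) \<Rightarrow> 'b set \<Rightarrow> bool" where
  "fin_dim_space s V \<longleftrightarrow>
     vector_space s \<and> module.subspace s V \<and> (\<exists>S. finite S \<and> module.span s S = V)"

definition lin_map_on ::
  "('k::field \<Rightarrow> 'b::ab_group_add \<Rightarrow> 'b) \<Rightarrow> 'b set \<Rightarrow>
   ('k \<Rightarrow> 'c::ab_group_add \<Rightarrow> 'c) \<Rightarrow> 'c set \<Rightarrow> ('b \<Rightarrow> 'c) \<Rightarrow> bool" where
  "lin_map_on s V t W \<phi> \<longleftrightarrow>
     \<phi> ` V \<subseteq> W \<and>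
     (\<forall>x\<in>V. \<forall>y\<in>V. \<phi> (x + y) = \<phi> x + \<phi> y) \<and>
     (\<forall>c. \<forall>x\<in>V. \<phi> (s c x) = t c (\<phi> x))"

text \<open>For a finite group, \<open>homog_decomp G X v p\<close> says that \<open>p\<close> is the family of homogeneous
  components of \<open>v\<close>.\<close>

definition homog_decomp ::
  "('g, 'm) monoid_scheme \<Rightarrow> ('g, 'k, 'b::ab_group_add, 'n) zobj_scheme \<Rightarrow>
   'b \<Rightarrow> ('g \<Rightarrow> 'b) \<Rightarrow> bool" where
  "homog_decomp G X v p \<longleftrightarrow> p \<in> (\<Pi>\<^sub>E g\<in>carrier G. homog X g) \<and> v = (\<Sum>g\<in>carrier G. p g)"

definition homog_comp ::
  "('g, 'm) monoid_scheme \<Rightarrow> ('g, 'k, 'b::ab_group_add, 'n) zobj_scheme \<Rightarrow> 'g \<Rightarrow> 'b \<Rightarrow> 'b" where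
  "homog_comp G X g v = (THE p. homog_decomp G X v p) g"

definition z_object ::
  "('g, 'm) monoid_scheme \<Rightarrow> ('g \<Rightarrow> 'g \<Rightarrow> 'g \<Rightarrow> 'k::field) \<Rightarrow>
   ('g, 'k, 'b::ab_group_add, 'n) zobj_scheme \<Rightarrow> bool" where
  "z_object G \<alpha> X \<longleftrightarrow>
     fin_dim_space (scl X) (vec X) \<and>
     (\<forall>g\<in>carrier G. module.subspace (scl X) (homog X g) \<and> homog X g \<subseteq> vec X) \<and>
     (\<forall>v\<in>vec X. \<exists>!p. homog_decomp G X v p) \<and>
     (\<forall>f\<in>carrier G. lin_map_on (scl X) (vec X) (scl X) (vec X) (act X f) \<and>
                     bij_betw (act X f) (vec X) (vec X)) \<and>
     (\<forall>f\<in>carrier G. \<forall>g\<in>carrier G. act X f ` homog X g = homog X (conjg G f g)) \<and>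
     (\<forall>f\<in>carrier G. \<forall>g\<in>carrier G. \<forall>h\<in>carrier G. \<forall>v\<in>homog X h.
        act X (f \<otimes>\<^bsub>G\<^esub> g) v = scl X (act_cocycle G \<alpha> f g h) (act X f (act X g v)))"

definition z_morphism ::
  "('g, 'm) monoid_scheme \<Rightarrow> ('g, 'k::field, 'b::ab_group_add, 'n) zobj_scheme \<Rightarrow>
   ('g, 'k, 'c::ab_group_add, 'l) zobj_scheme \<Rightarrow> ('b \<Rightarrow> 'c) \<Rightarrow> bool" where
  "z_morphism G X Y \<phi> \<longleftrightarrow>
     lin_map_on (scl X) (vec X) (scl Y) (vec Y) \<phi> \<and>
     (\<forall>g\<in>carrier G. \<phi> ` homog X g \<subseteq> homog Y g) \<and>
     (\<forall>g\<in>carrier G. \<forall>x\<in>vec X. \<phi> (act X g x) = act Y g (\<phi> x))"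

text \<open>
  Morphisms \<open>X \<otimes> Y \<rightarrow> Z\<close>, given by the corresponding bilinear maps.  The last two clauses say that
  the linear map on the tensor product preserves the degree (\<open>x \<otimes> y\<close> has degree \<open>gh\<close> for \<open>x\<close>, \<open>y\<close>
  of degrees \<open>g\<close>, \<open>h\<close>) and commutes with the action
  \<open>f.(x \<otimes> y) = \<alpha>(f | g, h) (f.x \<otimes> f.y)\<close>.
\<close>

definition z_bimorphism ::
  "('g, 'm) monoid_scheme \<Rightarrow> ('g \<Rightarrow> 'g \<Rightarrow> 'g \<Rightarrow> 'k::field) \<Rightarrow>
   ('g, 'k, 'b::ab_group_add, 'n) zobj_scheme \<Rightarrow> ('g, 'k, 'c::ab_group_add, 'l) zobj_scheme \<Rightarrow>
   ('g, 'k, 'd::ab_group_add, 'o) zobj_scheme \<Rightarrow> ('b \<Rightarrow> 'c \<Rightarrow> 'd) \<Rightarrow> bool" where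
  "z_bimorphism G \<alpha> X Y Z \<mu> \<longleftrightarrow>
     (\<forall>x\<in>vec X. lin_map_on (scl Y) (vec Y) (scl Z) (vec Z) (\<lambda>y. \<mu> x y)) \<and>
     (\<forall>y\<in>vec Y. lin_map_on (scl X) (vec X) (scl Z) (vec Z) (\<lambda>x. \<mu> x y)) \<and>
     (\<forall>g\<in>carrier G. \<forall>h\<in>carrier G. \<forall>x\<in>homog X g. \<forall>y\<in>homog Y h.
        \<mu> x y \<in> homog Z (g \<otimes>\<^bsub>G\<^esub> h)) \<and>
     (\<forall>f\<in>carrier G. \<forall>g\<in>carrier G. \<forall>h\<in>carrier G. \<forall>x\<in>homog X g. \<forall>y\<in>homog Y h.
        act Z f (\<mu> x y) = scl Z (tensor_cocycle G \<alpha> f g h) (\<mu> (act X f x) (act Y f y)))"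


section \<open>Algebras in \<open>Z(G, \<alpha>)\<close>\<close>

record ('g, 'k, 'b) zalg = "('g, 'k, 'b) zobj" +
  mul :: "'b \<Rightarrow> 'b \<Rightarrow> 'b"
  unt :: "'b"

text \<open>
  The unit morphism from the unit object (\<open>k\<close> in degree \<open>e\<close> with trivial action) is given by the
  image \<open>unt A\<close> of \<open>1\<close>, an invariant element of degree \<open>e\<close>.  Associativity
  is \<open>\<mu> (id \<otimes> \<mu>) = \<mu> (\<mu> \<otimes> id) \<circ> a\<close> with \<open>a\<close> the associativity constraint; the unit
  constraints are the identities because \<open>\<alpha>\<close> is normalised.
\<close>

definition z_algebra ::
  "('g, 'm) monoid_scheme \<Rightarrow> ('g \<Rightarrow> 'g \<Rightarrow> 'g \<Rightarrow> 'k::field) \<Rightarrow>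
   ('g, 'k, 'b::ab_group_add) zalg \<Rightarrow> bool" where
  "z_algebra G \<alpha> A \<longleftrightarrow>
     z_object G \<alpha> A \<and>
     z_bimorphism G \<alpha> A A A (mul A) \<and>
     (\<forall>f\<in>carrier G. \<forall>g\<in>carrier G. \<forall>h\<in>carrier G.
        \<forall>a\<in>homog A f. \<forall>b\<in>homog A g. \<forall>c\<in>homog A h.
          mul A a (mul A b c) = scl A (\<alpha> f g h) (mul A (mul A a b) c)) \<and>
     unt A \<in> homog A \<one>\<^bsub>G\<^esub> \<and>
     (\<forall>g\<in>carrier G. act A g (unt A) = unt A) \<and>
     (\<forall>a\<in>vec A. mul A (unt A) a = a \<and> mul A a (unt A) = a)"

definition z_alg_iso ::
  "('g, 'm) monoid_scheme \<Rightarrow> ('g, 'k::field, 'b::ab_group_add) zalg \<Rightarrow>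
   ('g, 'k, 'c::ab_group_add) zalg \<Rightarrow> ('b \<Rightarrow> 'c) \<Rightarrow> bool" where
  "z_alg_iso G A B \<phi> \<longleftrightarrow>
     z_morphism G A B \<phi> \<and> bij_betw \<phi> (vec A) (vec B) \<and>
     (\<forall>a\<in>vec A. \<forall>b\<in>vec A. \<phi> (mul A a b) = mul B (\<phi> a) (\<phi> b)) \<and>
     \<phi> (unt A) = unt B"

definition z_alg_isomorphic ::
  "('g, 'm) monoid_scheme \<Rightarrow> ('g, 'k::field, 'b::ab_group_add) zalg \<Rightarrow>
   ('g, 'k, 'c::ab_group_add) zalg \<Rightarrow> bool" where
  "z_alg_isomorphic G A B \<longleftrightarrow> (\<exists>\<phi>. z_alg_iso G A B \<phi>)"

text \<open>The braiding is \<open>c (a \<otimes> b) = f.b \<otimes> a\<close> for \<open>a\<close> of degree \<open>f\<close>.\<close>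

definition z_commutative ::
  "('g, 'm) monoid_scheme \<Rightarrow> ('g, 'k, 'b) zalg \<Rightarrow> bool" where
  "z_commutative G A \<longleftrightarrow>
     (\<forall>f\<in>carrier G. \<forall>a\<in>homog A f. \<forall>b\<in>vec A. mul A a b = mul A (act A f b) a)"

definition z_alg_sum ::
  "('g, 'k, 'b) zalg \<Rightarrow> ('g, 'k, 'c) zalg \<Rightarrow> ('g, 'k, 'b \<times> 'c) zalg" where
  "z_alg_sum A B =
     \<lparr> vec = vec A \<times> vec B,
       scl = (\<lambda>c x. (scl A c (fst x), scl B c (snd x))),
       homog = (\<lambda>g. homog A g \<times> homog B g),
       act = (\<lambda>g x. (act A g (fst x), act B g (snd x))),
       mul = (\<lambda>x y. (mul A (fst x) (fst y), mul B (snd x) (snd y))),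
       unt = (unt A, unt B) \<rparr>"

text \<open>
  It is no restriction that the summands below live in the same type as \<open>A\<close>: they embed into \<open>A\<close>.
\<close>

definition z_indecomposable ::
  "('g, 'm) monoid_scheme \<Rightarrow> ('g \<Rightarrow> 'g \<Rightarrow> 'g \<Rightarrow> 'k::field) \<Rightarrow>
   ('g, 'k, 'b::ab_group_add) zalg \<Rightarrow> bool" where
  "z_indecomposable G \<alpha> A \<longleftrightarrow>
     \<not> (\<exists>(A1 :: ('g, 'k, 'b) zalg) (A2 :: ('g, 'k, 'b) zalg).
          z_algebra G \<alpha> A1 \<and> z_algebra G \<alpha> A2 \<and> vec A1 \<noteq> {0} \<and> vec A2 \<noteq> {0} \<and>
          z_alg_isomorphic G A (z_alg_sum A1 A2))"

text \<open>The trace of an endomorphism \<open>T\<close> of a finite dimensional space \<open>V\<close>, computed in some basis.\<close>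

definition lin_trace ::
  "('k::field \<Rightarrow> 'b::ab_group_add \<Rightarrow> 'b) \<Rightarrow> 'b set \<Rightarrow> ('b \<Rightarrow> 'b) \<Rightarrow> 'k" where
  "lin_trace s V T =
     (let S = (SOME S. finite S \<and> \<not> module.dependent s S \<and> module.span s S = V)
      in \<Sum>b\<in>S. module.representation s S (T b) b)"

definition trace_fun ::
  "('g, 'm) monoid_scheme \<Rightarrow> ('g, 'k::field, 'b::ab_group_add) zalg \<Rightarrow> 'b \<Rightarrow> 'k" where
  "trace_fun G A a = lin_trace (scl A) (vec A) (\<lambda>x. mul A (homog_comp G A \<one>\<^bsub>G\<^esub> a) x)"

definition z_separable ::
  "('g, 'm) monoid_scheme \<Rightarrow> ('g, 'k::field, 'b::ab_group_add) zalg \<Rightarrow> bool" where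
  "z_separable G A \<longleftrightarrow>
     (\<forall>a\<in>vec A. a \<noteq> 0 \<longrightarrow> (\<exists>b\<in>vec A. trace_fun G A (mul A a b) \<noteq> 0)) \<and>
     (\<forall>b\<in>vec A. b \<noteq> 0 \<longrightarrow> (\<exists>a\<in>vec A. trace_fun G A (mul A a b) \<noteq> 0))"

definition z_etale ::
  "('g, 'm) monoid_scheme \<Rightarrow> ('g \<Rightarrow> 'g \<Rightarrow> 'g \<Rightarrow> 'k::field) \<Rightarrow>
   ('g, 'k, 'b::ab_group_add) zalg \<Rightarrow> bool" where
  "z_etale G \<alpha> A \<longleftrightarrow>
     z_algebra G \<alpha> A \<and> z_indecomposable G \<alpha> A \<and> z_commutative G A \<and> z_separable G A"

text \<open>\<open>A\<^sub>e = k\<close>: the unit morphism identifies \<open>k\<close> with the component of degree \<open>e\<close>.\<close>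

definition trivial_component ::
  "('g, 'm) monoid_scheme \<Rightarrow> ('g, 'k::field, 'b::ab_group_add) zalg \<Rightarrow> bool" where
  "trivial_component G A \<longleftrightarrow> bij_betw (\<lambda>c. scl A c (unt A)) UNIV (homog A \<one>\<^bsub>G\<^esub>)"


section \<open>Twisted group algebras\<close>

text \<open>
  \<open>twisted_group_data H \<alpha> F \<gamma> \<epsilon>\<close>: \<open>F\<close> is a normal subgroup of \<open>H\<close>, \<open>\<gamma>\<close> is a normalised
  2-cochain on \<open>F\<close> with \<open>d(\<gamma>) = \<alpha>|\<^sub>F\<close>, and \<open>\<epsilon> h f\<close> (for \<open>\<epsilon>\<^sub>h(f)\<close>) is non-zero and satisfies the
  two compatibility conditions.
\<close>

definition twisted_group_data ::
  "('g, 'm) monoid_scheme \<Rightarrow> ('g \<Rightarrow> 'g \<Rightarrow> 'g \<Rightarrow> 'k::field) \<Rightarrow>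
   'g set \<Rightarrow> ('g \<Rightarrow> 'g \<Rightarrow> 'k) \<Rightarrow> ('g \<Rightarrow> 'g \<Rightarrow> 'k) \<Rightarrow> bool" where
  "twisted_group_data H \<alpha> F \<gamma> \<epsilon> \<longleftrightarrow>
     F \<lhd> H \<and>
     normalised_2cochain (H\<lparr>carrier := F\<rparr>) \<gamma> \<and>
     (\<forall>f\<in>F. \<forall>g\<in>F. \<forall>h\<in>F. coboundary2 (H\<lparr>carrier := F\<rparr>) \<gamma> f g h = \<alpha> f g h) \<and>
     (\<forall>h\<in>carrier H. \<forall>f\<in>F. \<epsilon> h f \<noteq> 0) \<and>
     (\<forall>g\<in>carrier H. \<forall>h\<in>carrier H. \<forall>f\<in>F.
        \<epsilon> (g \<otimes>\<^bsub>H\<^esub> h) f = \<epsilon> g (conjg H h f) * \<epsilon> h f * act_cocycle H \<alpha> g h f) \<and>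
     (\<forall>h\<in>carrier H. \<forall>f\<in>F. \<forall>g\<in>F.
        \<gamma> f g * \<epsilon> h (f \<otimes>\<^bsub>H\<^esub> g)
          = tensor_cocycle H \<alpha> h f g * \<epsilon> h f * \<epsilon> h g * \<gamma> (conjg H h f) (conjg H h g))"

text \<open>The space with basis \<open>e\<^sub>f\<close>, \<open>f \<in> F\<close>, is realised as the functions vanishing outside \<open>F\<close>.\<close>

definition fun_scale :: "'k::field \<Rightarrow> ('g \<Rightarrow> 'k) \<Rightarrow> 'g \<Rightarrow> 'k" where
  "fun_scale c u = (\<lambda>x. c * u x)"

definition basis_elem :: "'g \<Rightarrow> 'g \<Rightarrow> 'k::field" where
  "basis_elem f = (\<lambda>x. if x = f then 1 else 0)"

text \<open>The algebra \<open>k[F, \<gamma>]\<close> with the action \<open>h.e\<^sub>f = \<epsilon>\<^sub>h(f) e\<^bsub>hfh\<inverse>\<^esub>\<close>; the formulas for \<open>act\<close> and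
  \<open>mul\<close> are the linear extensions from the basis.\<close>

definition twisted_group_alg ::
  "('g, 'm) monoid_scheme \<Rightarrow> 'g set \<Rightarrow> ('g \<Rightarrow> 'g \<Rightarrow> 'k::field) \<Rightarrow> ('g \<Rightarrow> 'g \<Rightarrow> 'k) \<Rightarrow>
   ('g, 'k, 'g \<Rightarrow> 'k) zalg" where
  "twisted_group_alg H F \<gamma> \<epsilon> =
     \<lparr> vec = {u. \<forall>x. x \<notin> F \<longrightarrow> u x = 0},
       scl = fun_scale,
       homog = (\<lambda>g. {u. \<forall>x. \<not> (x \<in> F \<and> x = g) \<longrightarrow> u x = 0}),
       act = (\<lambda>h u. \<Sum>f\<in>F. fun_scale (u f * \<epsilon> h f) (basis_elem (conjg H h f))),
       mul = (\<lambda>u v. \<Sum>f\<in>F. \<Sum>g\<in>F. fun_scale (u f * v g * \<gamma> f g) (basis_elem (f \<otimes>\<^bsub>H\<^esub> g))),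
       unt = basis_elem \<one>\<^bsub>H\<^esub> \<rparr>"

end

theory Submission
  imports Defs
begin

text \<open>
  Separability gives every nonzero homogeneous element \<open>a\<close> of \<open>B\<close> a partner \<open>b\<close> of inverse
  degree with \<open>\<tau>(ab) \<noteq> 0\<close>; since \<open>B\<^sub>e = k\<close>, the product \<open>ab\<close> is a nonzero scalar.  So nonzero
  homogeneous elements are invertible up to associativity scalars, every component has dimension
  at most one, and the degrees that occur form a subgroup, normal because \<open>h.B\<^sub>f\<close> is the
  component of degree \<open>hfh\<inverse>\<close>.  The structure constants of the product and of the action in a
  homogeneous basis are \<open>\<gamma>\<close> and \<open>\<epsilon>\<close>, and the algebra axioms are precisely the required
  identities.  Conversely, in \<open>k[F, \<gamma>]\<close> the pairing of \<open>e\<^sub>f\<close> with the basis element of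
  degree \<open>f\<inverse>\<close> is \<open>|F| \<gamma>(f, f\<inverse>) \<noteq> 0\<close>, and the component of degree \<open>e\<close> is one-dimensional,
  so that it contains no nontrivial idempotent.
\<close>

section \<open>Linear algebra on subspaces: bases, traces, sums\<close>

lemma fin_dim_space_basis:
  assumes "fin_dim_space s V"
  obtains S where "finite S" "\<not> module.dependent s S" "module.span s S = V"
proof -
  from assms interpret vector_space s by (simp add: fin_dim_space_def)
  from assms obtain T where T: "finite T" "span T = V" by (auto simp: fin_dim_space_def)
  obtain S where S: "S \<subseteq> V" "independent S" "V \<subseteq> span S" "card S = dim V"
    using basis_exists by blast
  have "finite S" using independent_span_bound[of T S] S T by auto
  moreover have "span S = V"
    using S span_minimal[of S V] assms by (simp add: fin_dim_space_def subset_antisym)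
  ultimately show ?thesis using S that by auto
qed

text \<open>For a scalar operator every diagonal coefficient is \<open>c\<close> in any basis, so
  the basis picked by \<open>SOME\<close> in \<open>lin_trace\<close> does not influence the result.
  Only such traces occur below, because in both halves the component of degree \<open>\<one>\<close>
  consists of multiples of the unit.\<close>

lemma lin_trace_scalar:
  assumes V: "fin_dim_space s V" and T: "\<And>x. x \<in> V \<Longrightarrow> T x = s c x"
  shows "lin_trace s V T = of_nat (vector_space.dim s V) * c"
proof -
  from V interpret vector_space s by (simp add: fin_dim_space_def)
  define S where "S = (SOME S. finite S \<and> independent S \<and> span S = V)"
  have S: "finite S \<and> independent S \<and> span S = V"
    unfolding S_def by (rule someI_ex) (metis fin_dim_space_basis[OF V])
  have "lin_trace s V T = (\<Sum>b\<in>S. representation S (T b) b)"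
    by (simp add: lin_trace_def S_def Let_def)
  also have "\<dots> = (\<Sum>b\<in>S. c)"
  proof (rule sum.cong)
    fix b assume b: "b \<in> S"
    then have bV: "b \<in> V" using S span_base by blast
    then have "representation S (T b) b = c * representation S b b"
      using S T by (simp add: representation_scale)
    then show "representation S (T b) b = c" using S b by (simp add: representation_basis)
  qed simp
  also have "\<dots> = of_nat (dim V) * c"
    using S dim_eq_card[of S V] by (metis span_span sum_constant)
  finally show ?thesis .
qed

lemma fin_dim_space_dim_pos:
  assumes V: "fin_dim_space s V" and "V \<noteq> {0}"
  shows "vector_space.dim s V > 0"
proof -
  from V interpret vector_space s by (simp add: fin_dim_space_def)
  obtain S where S: "finite S" "independent S" "span S = V"
    using fin_dim_space_basis[OF V] .
  then have "dim V = card S" using dim_eq_card[of S V] by (metis span_span)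
  moreover have "S \<noteq> {}" using S assms(2) by auto
  ultimately show ?thesis using S by (simp add: card_gt_0_iff)
qed

lemma lin_map_on_zero:
  assumes "lin_map_on s V t W \<phi>" "0 \<in> V"
  shows "\<phi> 0 = 0"
proof -
  have "\<phi> (0 + 0) = \<phi> 0 + \<phi> 0" using assms unfolding lin_map_on_def by blast
  then show ?thesis by simp
qed

lemma lin_map_on_sum:
  assumes L: "lin_map_on s V t W \<phi>" and V: "vector_space s" "module.subspace s V"
    and x: "\<And>i. i \<in> I \<Longrightarrow> x i \<in> V"
  shows "\<phi> (\<Sum>i\<in>I. x i) = (\<Sum>i\<in>I. \<phi> (x i))"
proof -
  interpret vector_space s by fact
  have z: "\<phi> 0 = 0" using lin_map_on_zero[OF L] V(2) subspace_0 by blast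
  have add: "\<phi> (a + b) = \<phi> a + \<phi> b" if "a \<in> V" "b \<in> V" for a b
    using L that by (auto simp: lin_map_on_def)
  show ?thesis using x
    by (induction I rule: infinite_finite_induct) (simp_all add: z add subspace_sum[OF V(2)])
qed

section \<open>Objects and algebras of \<open>Z(K, \<alpha>)\<close>\<close>

locale finite_cocycle = group K for K (structure) +
  fixes \<alpha> :: "'a \<Rightarrow> 'a \<Rightarrow> 'a \<Rightarrow> 'k::field"
  assumes fin: "finite (carrier K)" and cocycle: "normalised_3cocycle K \<alpha>"
begin

lemma conjg_closed [simp]: "g \<in> carrier K \<Longrightarrow> h \<in> carrier K \<Longrightarrow> conjg K g h \<in> carrier K"
  by (simp add: conjg_def)

lemma conjg_one [simp]: "g \<in> carrier K \<Longrightarrow> conjg K g \<one> = \<one>"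
  by (simp add: conjg_def)

lemma conjg_mult:
  "\<lbrakk>f \<in> carrier K; g \<in> carrier K; h \<in> carrier K\<rbrakk>
    \<Longrightarrow> conjg K (f \<otimes> g) h = conjg K f (conjg K g h)"
  by (simp add: conjg_def m_assoc inv_mult_group)

lemma conjg_hom:
  "\<lbrakk>f \<in> carrier K; g \<in> carrier K; h \<in> carrier K\<rbrakk>
    \<Longrightarrow> conjg K f (g \<otimes> h) = conjg K f g \<otimes> conjg K f h"
  by (simp add: conjg_def m_assoc inv_solve_left)

lemma conjg_inv_left [simp]:
  "\<lbrakk>f \<in> carrier K; g \<in> carrier K\<rbrakk> \<Longrightarrow> conjg K (inv f) (conjg K f g) = g"
  by (simp add: conjg_mult[symmetric]) (simp add: conjg_def)

lemma conjg_inv_right [simp]: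
  "\<lbrakk>f \<in> carrier K; g \<in> carrier K\<rbrakk> \<Longrightarrow> conjg K f (conjg K (inv f) g) = g"
  by (simp add: conjg_mult[symmetric]) (simp add: conjg_def)

lemma cocycle_nonzero:
  "\<lbrakk>f \<in> carrier K; g \<in> carrier K; h \<in> carrier K\<rbrakk> \<Longrightarrow> \<alpha> f g h \<noteq> 0"
  using cocycle by (auto simp: normalised_3cocycle_def)

lemma cocycle_normal [simp]:
  "\<lbrakk>g \<in> carrier K; h \<in> carrier K\<rbrakk> \<Longrightarrow> \<alpha> \<one> g h = 1"
  "\<lbrakk>g \<in> carrier K; h \<in> carrier K\<rbrakk> \<Longrightarrow> \<alpha> g \<one> h = 1"
  "\<lbrakk>g \<in> carrier K; h \<in> carrier K\<rbrakk> \<Longrightarrow> \<alpha> g h \<one> = 1"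
  using cocycle unfolding normalised_3cocycle_def by blast+

end

section \<open>Graded objects: the action and the homogeneous components\<close>

locale graded_object = finite_cocycle K \<alpha> for K (structure) and \<alpha> :: "'a \<Rightarrow> 'a \<Rightarrow> 'a \<Rightarrow> 'k::field" +
  fixes X :: "('a, 'k, 'b::ab_group_add, 'n) zobj_scheme"
  assumes obj: "z_object K \<alpha> X"
begin

lemma fin_dim: "fin_dim_space (scl X) (vec X)"
  using obj by (simp add: z_object_def)

sublocale vs: vector_space "scl X"
  using fin_dim by (simp add: fin_dim_space_def)

lemma subspace_vec: "vs.subspace (vec X)"
  using fin_dim by (simp add: fin_dim_space_def)

lemma subspace_homog: "g \<in> carrier K \<Longrightarrow> vs.subspace (homog X g)"
  using obj by (simp add: z_object_def)

lemma homog_vec: "g \<in> carrier K \<Longrightarrow> x \<in> homog X g \<Longrightarrow> x \<in> vec X"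
  using obj by (auto simp: z_object_def)

lemma act_lin: "f \<in> carrier K \<Longrightarrow> lin_map_on (scl X) (vec X) (scl X) (vec X) (act X f)"
  using obj by (simp add: z_object_def)

lemma act_bij: "f \<in> carrier K \<Longrightarrow> bij_betw (act X f) (vec X) (vec X)"
  using obj by (simp add: z_object_def)

lemma act_homog:
  "f \<in> carrier K \<Longrightarrow> g \<in> carrier K \<Longrightarrow> act X f ` homog X g = homog X (conjg K f g)"
  using obj by (simp add: z_object_def)

lemma act_mult:
  "\<lbrakk>f \<in> carrier K; g \<in> carrier K; h \<in> carrier K; v \<in> homog X h\<rbrakk>
    \<Longrightarrow> act X (f \<otimes> g) v = scl X (act_cocycle K \<alpha> f g h) (act X f (act X g v))"
  using obj by (simp add: z_object_def)

lemma act_scale: "f \<in> carrier K \<Longrightarrow> x \<in> vec X \<Longrightarrow> act X f (scl X c x) = scl X c (act X f x)"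
  using act_lin by (auto simp: lin_map_on_def)

lemma act_sum:
  "f \<in> carrier K \<Longrightarrow> (\<And>i. i \<in> I \<Longrightarrow> x i \<in> vec X) \<Longrightarrow> act X f (\<Sum>i\<in>I. x i) = (\<Sum>i\<in>I. act X f (x i))"
  using lin_map_on_sum[OF act_lin vs.vector_space_axioms subspace_vec] by blast

text \<open>Gives access to \<open>homog_comp\<close>, which is defined by \<open>THE\<close>: any
  explicit homogeneous decomposition computes the components.\<close>

lemma homog_comp_unique:
  assumes q: "\<And>g. g \<in> carrier K \<Longrightarrow> q g \<in> homog X g" and v: "v = (\<Sum>g\<in>carrier K. q g)"
    and g: "g \<in> carrier K"
  shows "homog_comp K X g v = q g"
proof -
  have "v \<in> vec X" unfolding v using q homog_vec by (intro vs.subspace_sum[OF subspace_vec]) auto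
  then have ex1: "\<exists>!p. homog_decomp K X v p" using obj by (simp add: z_object_def)
  \<comment> \<open>\<open>homog_decomp\<close> ranges over extensional families, whereas
    \<open>q\<close> is arbitrary outside the group; hence the restriction.\<close>
  have "homog_decomp K X v (restrict q (carrier K))"
    using q v by (auto simp: homog_decomp_def)
  then have "(THE p. homog_decomp K X v p) = restrict q (carrier K)"
    using ex1 by (metis the1_equality)
  then show ?thesis using g by (simp add: homog_comp_def)
qed

lemma
  assumes "v \<in> vec X"
  shows homog_comp_in: "g \<in> carrier K \<Longrightarrow> homog_comp K X g v \<in> homog X g"
    and homog_comp_sum: "(\<Sum>g\<in>carrier K. homog_comp K X g v) = v"
proof -
  have "\<exists>!p. homog_decomp K X v p" using obj assms by (simp add: z_object_def)
  then have *: "homog_decomp K X v (THE p. homog_decomp K X v p)" by (rule theI')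
  show "g \<in> carrier K \<Longrightarrow> homog_comp K X g v \<in> homog X g"
    using * by (auto simp: homog_decomp_def homog_comp_def)
  show "(\<Sum>g\<in>carrier K. homog_comp K X g v) = v"
    using * by (auto simp: homog_decomp_def homog_comp_def)
qed

lemma homog_comp_homog:
  assumes "x \<in> homog X f" "f \<in> carrier K" "g \<in> carrier K"
  shows "homog_comp K X g x = (if g = f then x else 0)"
  by (rule homog_comp_unique[where q = "\<lambda>g. if g = f then x else 0"])
     (use assms fin vs.subspace_0[OF subspace_homog] in auto)

end

section \<open>Algebras: products, the canonical trace, indecomposability\<close>

locale graded_algebra = finite_cocycle K \<alpha> for K (structure) and \<alpha> :: "'a \<Rightarrow> 'a \<Rightarrow> 'a \<Rightarrow> 'k::field" +
  fixes B :: "('a, 'k, 'b::ab_group_add) zalg"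
  assumes alg: "z_algebra K \<alpha> B"
begin

sublocale graded_object K \<alpha> B
  by unfold_locales (use alg in \<open>simp add: z_algebra_def\<close>)

lemma mul_lin_right: "x \<in> vec B \<Longrightarrow> lin_map_on (scl B) (vec B) (scl B) (vec B) (\<lambda>y. mul B x y)"
  using alg by (simp add: z_algebra_def z_bimorphism_def)

lemma mul_lin_left: "y \<in> vec B \<Longrightarrow> lin_map_on (scl B) (vec B) (scl B) (vec B) (\<lambda>x. mul B x y)"
  using alg by (simp add: z_algebra_def z_bimorphism_def)

lemma mul_scale_right: "x \<in> vec B \<Longrightarrow> y \<in> vec B \<Longrightarrow> mul B x (scl B c y) = scl B c (mul B x y)"
  using mul_lin_right by (auto simp: lin_map_on_def)

lemma mul_scale_left: "x \<in> vec B \<Longrightarrow> y \<in> vec B \<Longrightarrow> mul B (scl B c x) y = scl B c (mul B x y)"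
  using mul_lin_left by (auto simp: lin_map_on_def)

lemma mul_zero_right: "x \<in> vec B \<Longrightarrow> mul B x 0 = 0"
  using lin_map_on_zero[OF mul_lin_right] vs.subspace_0[OF subspace_vec] by blast

lemma mul_sum_right:
  "x \<in> vec B \<Longrightarrow> (\<And>i. i \<in> I \<Longrightarrow> y i \<in> vec B) \<Longrightarrow> mul B x (\<Sum>i\<in>I. y i) = (\<Sum>i\<in>I. mul B x (y i))"
  using lin_map_on_sum[OF mul_lin_right vs.vector_space_axioms subspace_vec] by blast

lemma mul_sum_left:
  "y \<in> vec B \<Longrightarrow> (\<And>i. i \<in> I \<Longrightarrow> x i \<in> vec B) \<Longrightarrow> mul B (\<Sum>i\<in>I. x i) y = (\<Sum>i\<in>I. mul B (x i) y)"
  using lin_map_on_sum[OF mul_lin_left vs.vector_space_axioms subspace_vec] by blast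

lemma mul_homog:
  "\<lbrakk>g \<in> carrier K; h \<in> carrier K; x \<in> homog B g; y \<in> homog B h\<rbrakk> \<Longrightarrow> mul B x y \<in> homog B (g \<otimes> h)"
  using alg by (simp add: z_algebra_def z_bimorphism_def)

lemma act_mul:
  "\<lbrakk>f \<in> carrier K; g \<in> carrier K; h \<in> carrier K; x \<in> homog B g; y \<in> homog B h\<rbrakk>
    \<Longrightarrow> act B f (mul B x y) = scl B (tensor_cocycle K \<alpha> f g h) (mul B (act B f x) (act B f y))"
  using alg by (simp add: z_algebra_def z_bimorphism_def)

lemma mul_assoc:
  "\<lbrakk>f \<in> carrier K; g \<in> carrier K; h \<in> carrier K; a \<in> homog B f; b \<in> homog B g; c \<in> homog B h\<rbrakk>
    \<Longrightarrow> mul B a (mul B b c) = scl B (\<alpha> f g h) (mul B (mul B a b) c)"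
  using alg by (simp add: z_algebra_def)

lemma unt_homog: "unt B \<in> homog B \<one>"
  using alg by (simp add: z_algebra_def)

lemma unt_vec: "unt B \<in> vec B"
  using unt_homog homog_vec by blast

lemma unt_mul [simp]: "a \<in> vec B \<Longrightarrow> mul B (unt B) a = a" "a \<in> vec B \<Longrightarrow> mul B a (unt B) = a"
  using alg by (auto simp: z_algebra_def)

text \<open>The canonical trace sees only degree \<open>\<one>\<close>; if that component is
  \<open>c\<close> times the unit, left multiplication by it is the scalar \<open>c\<close>. Thus
  the trace reads off the coefficient of the unit up to the factor \<open>dim\<close>.\<close>

lemma trace_fun_scalar:
  assumes "homog_comp K B \<one> v = scl B c (unt B)"
  shows "trace_fun K B v = of_nat (vs.dim (vec B)) * c"
  unfolding trace_fun_def assms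
  by (rule lin_trace_scalar[OF fin_dim]) (simp add: mul_scale_left unt_vec)

lemma mul_zero_left: "x \<in> vec B \<Longrightarrow> mul B 0 x = 0"
  using lin_map_on_zero[OF mul_lin_left] vs.subspace_0[OF subspace_vec] by blast

lemma unt_nonzero_if:
  assumes "vec B \<noteq> {0}"
  shows "unt B \<noteq> 0"
proof
  assume "unt B = 0"
  then have "x = 0" if "x \<in> vec B" for x using that unt_mul(1)[of x] mul_zero_left by simp
  then show False using assms vs.subspace_0[OF subspace_vec] by auto
qed

text \<open>The unit of a direct summand corresponds to an idempotent of \<open>B\<close> of degree \<open>\<one>\<close>.\<close>

lemma indecomposableI:
  assumes triv: "homog B \<one> \<subseteq> range (\<lambda>c. scl B c (unt B))"
  shows "z_indecomposable K \<alpha> B"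
  unfolding z_indecomposable_def
proof clarify
  fix A1 A2 :: "('a, 'k, 'b) zalg"
  assume A1: "z_algebra K \<alpha> A1" "vec A1 \<noteq> {0}" and A2: "z_algebra K \<alpha> A2" "vec A2 \<noteq> {0}"
    and iso: "z_alg_isomorphic K B (z_alg_sum A1 A2)"
  interpret A1: graded_algebra K \<alpha> A1 by unfold_locales fact
  interpret A2: graded_algebra K \<alpha> A2 by unfold_locales fact
  obtain \<phi> where \<phi>: "z_alg_iso K B (z_alg_sum A1 A2) \<phi>"
    using iso by (auto simp: z_alg_isomorphic_def)
  have lin: "lin_map_on (scl B) (vec B) (scl (z_alg_sum A1 A2)) (vec (z_alg_sum A1 A2)) \<phi>"
    using \<phi> by (simp add: z_alg_iso_def z_morphism_def)
  have "(unt A1, 0) \<in> \<phi> ` vec B"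
    using \<phi> A1.unt_vec A2.vs.subspace_0[OF A2.subspace_vec]
    by (auto simp: z_alg_iso_def bij_betw_def z_alg_sum_def)
  then obtain x where x: "x \<in> vec B" "\<phi> x = (unt A1, 0)" by (metis imageE)
  \<comment> \<open>The preimage \<open>x\<close> of \<open>(1, 0)\<close> need not be known to be
    homogeneous. Its components are pushed through \<open>\<phi>\<close> and compared with those of
    \<open>(1, 0)\<close>, which lies in degree \<open>\<one>\<close>.\<close>
  define q where "q g = \<phi> (homog_comp K B g x)" for g
  have q: "fst (q g) \<in> homog A1 g" "snd (q g) \<in> homog A2 g" if "g \<in> carrier K" for g
  proof -
    have "q g \<in> homog (z_alg_sum A1 A2) g"
      unfolding q_def using \<phi> that homog_comp_in[OF x(1), of g]
      by (auto simp: z_alg_iso_def z_morphism_def)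
    then show "fst (q g) \<in> homog A1 g" "snd (q g) \<in> homog A2 g" by (auto simp: z_alg_sum_def)
  qed
  have sum: "\<phi> x = (\<Sum>g\<in>carrier K. q g)"
    unfolding q_def
    using lin_map_on_sum[OF lin vs.vector_space_axioms subspace_vec,
        of "carrier K" "\<lambda>g. homog_comp K B g x"] homog_comp_in[OF x(1)] homog_vec
    by (simp add: homog_comp_sum x(1))
  have "unt A1 = homog_comp K A1 \<one> (unt A1)"
    using A1.homog_comp_homog[OF A1.unt_homog] by simp
  also have "\<dots> = fst (q \<one>)"
    by (rule A1.homog_comp_unique) (use q x sum in \<open>simp_all flip: fst_sum\<close>)
  finally have q1: "fst (q \<one>) = unt A1" by simp
  have "0 = homog_comp K A2 \<one> 0"
    using A2.homog_comp_homog[of 0 \<one> \<one>] A2.vs.subspace_0[OF A2.subspace_homog] by simp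
  also have "\<dots> = snd (q \<one>)"
    by (rule A2.homog_comp_unique) (use q x sum in \<open>simp_all flip: snd_sum\<close>)
  finally have q2: "snd (q \<one>) = 0" by simp
  \<comment> \<open>Now \<open>q \<one>\<close> equals \<open>(1, 0)\<close>, but as the image of a
    multiple of the unit it is also \<open>(c, c)\<close>. The second entry forces
    \<open>c = 0\<close>, and then the first makes the unit of \<open>A1\<close> vanish.\<close>
  obtain c where "homog_comp K B \<one> x = scl B c (unt B)"
    using triv homog_comp_in[OF x(1)] by blast
  then have "q \<one> = scl (z_alg_sum A1 A2) c (\<phi> (unt B))"
    using lin unt_vec by (simp add: q_def lin_map_on_def)
  then have "q \<one> = (scl A1 c (unt A1), scl A2 c (unt A2))"
    using \<phi> by (simp add: z_alg_iso_def z_alg_sum_def)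
  then show False
    using q1 q2 A1.unt_nonzero_if A2.unt_nonzero_if A1 A2 by auto
qed

end

section \<open>Separable algebras with trivial component\<close>

locale separable_trivial_algebra = graded_algebra K \<alpha> B
  for K (structure) and \<alpha> :: "'a \<Rightarrow> 'a \<Rightarrow> 'a \<Rightarrow> 'k::field_char_0"
    and B :: "('a, 'k, 'b::ab_group_add) zalg" +
  assumes sep: "z_separable K B" and triv: "trivial_component K B"
begin

section \<open>Invertibility of nonzero homogeneous elements\<close>

lemma unt_nonzero: "unt B \<noteq> 0"
proof
  assume "unt B = 0"
  then have "scl B 0 (unt B) = scl B 1 (unt B)" by simp
  then show False
    using triv unfolding trivial_component_def bij_betw_def
    by (metis UNIV_I inj_onD zero_neq_one)
qed

lemma homog_one_scalar: "x \<in> homog B \<one> \<Longrightarrow> \<exists>c. x = scl B c (unt B)"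
  using triv by (auto simp: trivial_component_def bij_betw_def)

text \<open>Nondegeneracy yields \<open>b\<close> with nonzero trace of \<open>ab\<close>. Only the
  component of \<open>b\<close> in degree \<open>inv f\<close> contributes to degree
  \<open>\<one>\<close> of \<open>ab\<close>, and there the product is a nonzero scalar that can be
  divided out.\<close>

lemma right_inverse:
  assumes f: "f \<in> carrier K" and a: "a \<in> homog B f" "a \<noteq> 0"
  shows "\<exists>b\<in>homog B (inv f). mul B a b = unt B"
proof -
  have aV: "a \<in> vec B" using f a homog_vec by blast
  then obtain b where b: "b \<in> vec B" "trace_fun K B (mul B a b) \<noteq> 0"
    using sep a by (auto simp: z_separable_def)
  \<comment> \<open>\<open>q h\<close> is the component of \<open>ab\<close> in degree
    \<open>h\<close>: since \<open>a\<close> has degree \<open>f\<close>, it comes from the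
    component of \<open>b\<close> in degree \<open>inv f \<otimes> h\<close>.\<close>
  define q where "q h = mul B a (homog_comp K B (inv f \<otimes> h) b)" for h
  have compV: "homog_comp K B g b \<in> vec B" if "g \<in> carrier K" for g
    using that b homog_comp_in homog_vec by blast
  have q: "q h \<in> homog B h" if "h \<in> carrier K" for h
    using mul_homog[of f "inv f \<otimes> h" a "homog_comp K B (inv f \<otimes> h) b"] that f a b
    by (simp add: q_def homog_comp_in m_assoc[symmetric])
  have bij: "bij_betw (\<lambda>h. inv f \<otimes> h) (carrier K) (carrier K)"
    by (rule bij_betwI[where g = "\<lambda>h. f \<otimes> h"]) (use f in \<open>auto simp: m_assoc[symmetric]\<close>)
  have "mul B a b = (\<Sum>g\<in>carrier K. mul B a (homog_comp K B g b))"
    by (subst homog_comp_sum[OF b(1), symmetric]) (simp add: mul_sum_right aV compV)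
  also have "\<dots> = (\<Sum>h\<in>carrier K. q h)"
    unfolding q_def by (rule sum.reindex_bij_betw[OF bij, symmetric])
  finally have comp: "homog_comp K B \<one> (mul B a b) = q \<one>"
    by (intro homog_comp_unique) (use q in auto)
  obtain c where c: "q \<one> = scl B c (unt B)" using q homog_one_scalar by blast
  have "c \<noteq> 0" using trace_fun_scalar[of "mul B a b" c] comp c b by auto
  define b' where "b' = scl B (inverse c) (homog_comp K B (inv f) b)"
  have "b' \<in> homog B (inv f)"
    unfolding b'_def using f b by (intro vs.subspace_scale subspace_homog homog_comp_in) auto
  moreover have "mul B a b' = unt B"
    using c f \<open>c \<noteq> 0\<close> compV aV by (simp add: b'_def q_def mul_scale_right)
  ultimately show ?thesis by blast
qed

text \<open>The usual argument that a right inverse \<open>b\<close> with its own right inverse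
  \<open>c\<close> is two-sided: comparing \<open>a(bc)\<close> with \<open>(ab)c\<close> gives
  \<open>a = \<alpha>(f, inv f, f) c\<close>. The associativity constraint survives as the scalar
  \<open>s\<close>, which is \<open>\<alpha>(f, inv f, f)\<close>.\<close>

lemma two_sided_inverse:
  assumes f: "f \<in> carrier K" and a: "a \<in> homog B f" "a \<noteq> 0"
  obtains b s where "b \<in> homog B (inv f)" "mul B a b = unt B" "mul B b a = scl B s (unt B)" "s \<noteq> 0"
proof -
  have aV: "a \<in> vec B" using f a homog_vec by blast
  obtain b where b: "b \<in> homog B (inv f)" "mul B a b = unt B" using right_inverse assms by blast
  have bV: "b \<in> vec B" using f b homog_vec by blast
  have "b \<noteq> 0" using b mul_zero_right aV unt_nonzero by auto
  then obtain c where c: "c \<in> homog B f" "mul B b c = unt B"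
    using right_inverse[of "inv f" b] f b by auto
  have cV: "c \<in> vec B" using f c homog_vec by blast
  have "a = scl B (\<alpha> f (inv f) f) c"
    using mul_assoc[of f "inv f" f a b c] f a b c aV cV by simp
  then have "mul B b a = scl B (\<alpha> f (inv f) f) (unt B)"
    using c bV cV by (simp add: mul_scale_right)
  moreover have "\<alpha> f (inv f) f \<noteq> 0" using f cocycle_nonzero by simp
  ultimately show ?thesis using that b by blast
qed

text \<open>With \<open>b\<close> the inverse of \<open>a\<close>, the product \<open>xb\<close>
  lies in degree \<open>\<one>\<close> and is a scalar \<open>t\<close>. Rebracketing
  \<open>x(ba)\<close> as \<open>(xb)a\<close> gives
  \<open>s x = \<alpha>(f, inv f, f) t a\<close>.\<close>

lemma homog_one_dim:
  assumes f: "f \<in> carrier K" and a: "a \<in> homog B f" "a \<noteq> 0" and x: "x \<in> homog B f"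
  shows "\<exists>c. x = scl B c a"
proof -
  have V: "a \<in> vec B" "x \<in> vec B" using f a x homog_vec by auto
  obtain b s where b: "b \<in> homog B (inv f)" "mul B b a = scl B s (unt B)" "s \<noteq> 0"
    using two_sided_inverse f a by metis
  have "mul B x b \<in> homog B \<one>" using mul_homog[of f "inv f" x b] f x b by simp
  then obtain t where t: "mul B x b = scl B t (unt B)" using homog_one_scalar by blast
  have "scl B s x = scl B (\<alpha> f (inv f) f) (scl B t a)"
    using mul_assoc[of f "inv f" f x b a] f a b x V t unt_vec
    by (simp add: mul_scale_left mul_scale_right)
  then have "scl B (inverse s) (scl B s x) = scl B (inverse s * (\<alpha> f (inv f) f * t)) a"
    by (simp add: mult.assoc)
  then show ?thesis using b by auto
qed

text \<open>If \<open>ax = 0\<close>, multiplying by the inverse \<open>b\<close> of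
  \<open>a\<close> and rebracketing gives a nonzero multiple of \<open>x\<close>, a contradiction.
  This is what closes the set of occurring degrees under products.\<close>

lemma mul_nonzero:
  assumes f: "f \<in> carrier K" "g \<in> carrier K"
    and a: "a \<in> homog B f" "a \<noteq> 0" and x: "x \<in> homog B g" "x \<noteq> 0"
  shows "mul B a x \<noteq> 0"
proof
  assume 0: "mul B a x = 0"
  have V: "a \<in> vec B" "x \<in> vec B" using f a x homog_vec by auto
  obtain b s where b: "b \<in> homog B (inv f)" "mul B b a = scl B s (unt B)" "s \<noteq> 0"
    using two_sided_inverse f a by metis
  have bV: "b \<in> vec B" using f b homog_vec by blast
  have "scl B (\<alpha> (inv f) f g) (scl B s x) = 0"
    using mul_assoc[of "inv f" f g b a x] f a b x V bV unt_vec
    by (simp add: mul_scale_left 0 mul_zero_right)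
  then show False using b x f cocycle_nonzero by simp
qed

section \<open>The support as a normal subgroup, and the structure constants\<close>

definition supp :: "'a set" where
  "supp = {f \<in> carrier K. homog B f \<noteq> {0}}"

text \<open>These elements become the basis \<open>e_f\<close>. Taking the unit in degree
  \<open>\<one>\<close> instead of an arbitrary element makes the cochain \<open>gen_mul\<close>
  normalised.\<close>

definition gen :: "'a \<Rightarrow> 'b" where
  "gen f = (if f = \<one> then unt B else SOME x. x \<in> homog B f \<and> x \<noteq> 0)"

definition coef :: "'a \<Rightarrow> 'b \<Rightarrow> 'k" where
  "coef f x = (THE c. x = scl B c (gen f))"

definition gen_mul :: "'a \<Rightarrow> 'a \<Rightarrow> 'k" where
  "gen_mul f g = coef (f \<otimes> g) (mul B (gen f) (gen g))"

definition gen_act :: "'a \<Rightarrow> 'a \<Rightarrow> 'k" where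
  "gen_act h f = coef (conjg K h f) (act B h (gen f))"

text \<open>The value 0 off \<open>supp\<close> puts the coordinates into the function space
  underlying \<open>twisted_group_alg\<close>.\<close>

definition coords :: "'b \<Rightarrow> 'a \<Rightarrow> 'k" where
  "coords v f = (if f \<in> supp then coef f (homog_comp K B f v) else 0)"

lemma supp_carrier: "f \<in> supp \<Longrightarrow> f \<in> carrier K"
  by (simp add: supp_def)

lemma finite_supp: "finite supp"
  using fin by (simp add: supp_def)

lemma supp_iff: "f \<in> supp \<longleftrightarrow> f \<in> carrier K \<and> (\<exists>x\<in>homog B f. x \<noteq> 0)"
  using vs.subspace_0[OF subspace_homog] by (auto simp: supp_def)

lemma one_supp: "\<one> \<in> supp"
  using unt_homog unt_nonzero by (auto simp: supp_iff)

lemma gen_one: "gen \<one> = unt B"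
  by (simp add: gen_def)

lemma gen_props: "f \<in> supp \<Longrightarrow> gen f \<in> homog B f \<and> gen f \<noteq> 0"
proof (cases "f = \<one>")
  case True
  then show ?thesis using unt_homog unt_nonzero by (simp add: gen_def)
next
  case False
  assume "f \<in> supp"
  then have "\<exists>x. x \<in> homog B f \<and> x \<noteq> 0" by (auto simp: supp_iff)
  from someI_ex[OF this] False show ?thesis by (simp add: gen_def)
qed

lemma gen_homog: "f \<in> supp \<Longrightarrow> gen f \<in> homog B f"
  and gen_nonzero: "f \<in> supp \<Longrightarrow> gen f \<noteq> 0"
  by (simp_all add: gen_props)

lemma gen_vec: "f \<in> supp \<Longrightarrow> gen f \<in> vec B"
  using gen_homog homog_vec supp_carrier by blast

lemma coef_scale: "f \<in> supp \<Longrightarrow> coef f (scl B c (gen f)) = c"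
  using gen_nonzero by (auto simp: coef_def)

lemma scale_coef: "f \<in> supp \<Longrightarrow> x \<in> homog B f \<Longrightarrow> scl B (coef f x) (gen f) = x"
proof -
  assume f: "f \<in> supp" and x: "x \<in> homog B f"
  then obtain c where "x = scl B c (gen f)"
    using homog_one_dim supp_carrier gen_homog gen_nonzero by blast
  then show ?thesis using f by (simp add: coef_scale)
qed

lemma supp_mult: "f \<in> supp \<Longrightarrow> g \<in> supp \<Longrightarrow> f \<otimes> g \<in> supp"
  unfolding supp_iff[of "f \<otimes> g"]
  by (intro conjI bexI[where x = "mul B (gen f) (gen g)"] mul_nonzero[of f g] mul_homog)
     (simp_all add: gen_homog gen_nonzero supp_carrier)

lemma supp_inv:
  assumes "f \<in> supp"
  shows "inv f \<in> supp"
proof -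
  obtain b where "b \<in> homog B (inv f)" "mul B (gen f) b = unt B"
    using right_inverse assms supp_carrier gen_props by metis
  then show ?thesis
    using assms supp_carrier gen_vec[OF assms] mul_zero_right unt_nonzero
    by (metis inv_closed supp_iff)
qed

lemma act_gen_nonzero:
  assumes "h \<in> carrier K" "f \<in> supp"
  shows "act B h (gen f) \<noteq> 0"
proof -
  have "act B h 0 = 0"
    using act_lin assms lin_map_on_zero vs.subspace_0[OF subspace_vec] by blast
  then show ?thesis
    using act_bij[of h] assms gen_vec gen_nonzero vs.subspace_0[OF subspace_vec]
    by (metis bij_betw_imp_inj_on inj_onD)
qed

lemma act_gen_homog:
  "h \<in> carrier K \<Longrightarrow> f \<in> supp \<Longrightarrow> act B h (gen f) \<in> homog B (conjg K h f)"
  using act_homog[of h f] supp_carrier gen_homog by blast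

lemma supp_conjg: "h \<in> carrier K \<Longrightarrow> f \<in> supp \<Longrightarrow> conjg K h f \<in> supp"
  unfolding supp_iff[of "conjg K h f"]
  using act_gen_nonzero act_gen_homog supp_carrier conjg_closed by blast

lemma supp_normal: "supp \<lhd> K"
  unfolding normal_inv_iff
  using supp_mult supp_inv one_supp supp_conjg supp_carrier
  by (auto simp: conjg_def intro!: subgroup.intro)

lemma mul_gen: "f \<in> supp \<Longrightarrow> g \<in> supp \<Longrightarrow> mul B (gen f) (gen g) = scl B (gen_mul f g) (gen (f \<otimes> g))"
  by (simp add: gen_mul_def scale_coef supp_mult mul_homog supp_carrier gen_homog)

lemma act_gen:
  "h \<in> carrier K \<Longrightarrow> f \<in> supp \<Longrightarrow> act B h (gen f) = scl B (gen_act h f) (gen (conjg K h f))"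
  by (simp add: gen_act_def scale_coef supp_conjg act_gen_homog)

lemma gen_scale_eq: "f \<in> supp \<Longrightarrow> scl B c (gen f) = scl B d (gen f) \<longleftrightarrow> c = d"
  using gen_nonzero by simp

lemma gen_mul_nonzero: "f \<in> supp \<Longrightarrow> g \<in> supp \<Longrightarrow> gen_mul f g \<noteq> 0"
  using mul_gen[of f g] mul_nonzero[of f g "gen f" "gen g"] gen_props[of f] gen_props[of g] supp_carrier
  by auto

lemma gen_act_nonzero: "h \<in> carrier K \<Longrightarrow> f \<in> supp \<Longrightarrow> gen_act h f \<noteq> 0"
  using act_gen[of h f] act_gen_nonzero[of h f] by auto

lemma gen_mul_one:
  assumes "f \<in> supp"
  shows "gen_mul \<one> f = 1" "gen_mul f \<one> = 1"
  using assms mul_gen[of \<one> f] mul_gen[of f \<one>] one_supp supp_carrier gen_vec[of f]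
    gen_scale_eq[of f 1]
  by (auto simp: gen_one)

text \<open>Both bracketings of three basis elements are expanded and the coefficients compared.
  This is \<open>d(\<gamma>) = \<alpha>\<close> with denominators cleared.\<close>

lemma gen_mul_assoc:
  assumes "f \<in> supp" "g \<in> supp" "h \<in> supp"
  shows "gen_mul g h * gen_mul f (g \<otimes> h) = \<alpha> f g h * gen_mul f g * gen_mul (f \<otimes> g) h"
proof -
  have "scl B (gen_mul g h * gen_mul f (g \<otimes> h)) (gen (f \<otimes> g \<otimes> h))
      = mul B (gen f) (mul B (gen g) (gen h))"
    using assms by (simp add: mul_gen mul_scale_right supp_mult gen_vec m_assoc supp_carrier)
  also have "\<dots> = scl B (\<alpha> f g h) (mul B (mul B (gen f) (gen g)) (gen h))"
    using assms by (intro mul_assoc gen_homog supp_carrier)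
  also have "\<dots> = scl B (\<alpha> f g h * gen_mul f g * gen_mul (f \<otimes> g) h) (gen (f \<otimes> g \<otimes> h))"
    using assms by (simp add: mul_gen mul_scale_left supp_mult gen_vec)
  finally show ?thesis using assms by (simp add: gen_nonzero supp_mult)
qed

text \<open>The projective action law evaluated on a basis element.\<close>

lemma gen_act_mult:
  assumes "g \<in> carrier K" "h \<in> carrier K" "f \<in> supp"
  shows "gen_act (g \<otimes> h) f = gen_act g (conjg K h f) * gen_act h f * act_cocycle K \<alpha> g h f"
proof -
  have "scl B (gen_act (g \<otimes> h) f) (gen (conjg K (g \<otimes> h) f)) = act B (g \<otimes> h) (gen f)"
    using assms by (simp add: act_gen)
  also have "\<dots> = scl B (act_cocycle K \<alpha> g h f) (act B g (act B h (gen f)))"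
    using assms by (simp add: act_mult gen_homog supp_carrier)
  also have "\<dots> = scl B (act_cocycle K \<alpha> g h f * (gen_act h f * gen_act g (conjg K h f)))
      (gen (conjg K (g \<otimes> h) f))"
    using assms by (simp add: act_gen act_scale supp_conjg gen_vec conjg_mult supp_carrier)
  finally show ?thesis using assms by (simp add: gen_nonzero supp_conjg mult_ac supp_carrier)
qed

text \<open>Compatibility of the product with the action, evaluated on two basis elements.\<close>

lemma gen_act_mul:
  assumes "h \<in> carrier K" "f \<in> supp" "g \<in> supp"
  shows "gen_mul f g * gen_act h (f \<otimes> g)
    = tensor_cocycle K \<alpha> h f g * gen_act h f * gen_act h g * gen_mul (conjg K h f) (conjg K h g)"
proof -
  have "scl B (gen_mul f g * gen_act h (f \<otimes> g)) (gen (conjg K h (f \<otimes> g)))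
      = act B h (mul B (gen f) (gen g))"
    using assms by (simp add: mul_gen act_gen act_scale supp_mult gen_vec)
  also have "\<dots> = scl B (tensor_cocycle K \<alpha> h f g) (mul B (act B h (gen f)) (act B h (gen g)))"
    using assms by (simp add: act_mul[of h f g] gen_homog supp_carrier)
  also have "\<dots> = scl B (tensor_cocycle K \<alpha> h f g *
      (gen_act h f * (gen_act h g * gen_mul (conjg K h f) (conjg K h g)))) (gen (conjg K h (f \<otimes> g)))"
    using assms
    by (simp add: act_gen mul_gen mul_scale_left mul_scale_right supp_conjg gen_vec conjg_hom
        supp_carrier supp_mult vs.subspace_scale[OF subspace_vec])
  finally show ?thesis using assms by (simp add: gen_nonzero supp_conjg supp_mult mult_ac)
qed

lemma twisted_group_data_supp: "twisted_group_data K \<alpha> supp gen_mul gen_act"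
  using supp_normal gen_mul_nonzero gen_mul_one gen_act_nonzero gen_act_mult gen_act_mul
    gen_mul_assoc supp_mult
  by (auto simp: twisted_group_data_def normalised_2cochain_def coboundary2_def divide_simps)

section \<open>Coordinates as an isomorphism onto the twisted group algebra\<close>

lemma coords_eqI:
  assumes u: "\<And>f. f \<notin> supp \<Longrightarrow> u f = 0" and v: "v = (\<Sum>f\<in>supp. scl B (u f) (gen f))"
  shows "coords v = u"
proof
  fix f
  \<comment> \<open>Extension by zero to all degrees turns the sum over \<open>supp\<close> into a
    homogeneous decomposition, whose components are unique.\<close>
  define q where "q f = (if f \<in> supp then scl B (u f) (gen f) else 0)" for f
  have "v = (\<Sum>f\<in>carrier K. q f)"
    unfolding v q_def using fin supp_carrier
    by (intro sum.mono_neutral_cong_left) auto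
  moreover have "q f \<in> homog B f" if "f \<in> carrier K" for f
    using that vs.subspace_0[OF subspace_homog] vs.subspace_scale[OF subspace_homog] gen_homog
    by (simp add: q_def)
  ultimately have "homog_comp K B f v = q f" if "f \<in> carrier K" using that homog_comp_unique by blast
  then show "coords v f = u f"
    using u supp_carrier by (auto simp: coords_def q_def coef_scale)
qed

lemma coords_expand:
  assumes "v \<in> vec B"
  shows "v = (\<Sum>f\<in>supp. scl B (coords v f) (gen f))"
proof -
  have "(\<Sum>f\<in>supp. scl B (coords v f) (gen f)) = (\<Sum>f\<in>supp. homog_comp K B f v)"
    using assms by (intro sum.cong) (simp_all add: coords_def scale_coef homog_comp_in supp_carrier)
  also have "\<dots> = (\<Sum>f\<in>carrier K. homog_comp K B f v)"
    using assms fin supp_carrier homog_comp_in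
    by (intro sum.mono_neutral_left) (auto simp: supp_def)
  finally show ?thesis using assms homog_comp_sum by simp
qed

lemma coords_gen: "f \<in> supp \<Longrightarrow> coords (gen f) = basis_elem f"
  by (rule coords_eqI)
     (auto simp: basis_elem_def finite_supp if_distrib[of "\<lambda>c. scl B c _"] cong: if_cong)

lemma coords_lin:
  "lin_map_on (scl B) (vec B) fun_scale {u. \<forall>x. x \<notin> supp \<longrightarrow> u x = 0} coords"
  unfolding lin_map_on_def
proof (intro conjI ballI allI)
  show "coords ` vec B \<subseteq> {u. \<forall>x. x \<notin> supp \<longrightarrow> u x = 0}" by (auto simp: coords_def)
  show "coords (x + y) = coords x + coords y" if "x \<in> vec B" "y \<in> vec B" for x y
  proof (rule coords_eqI)
    have "x + y = (\<Sum>f\<in>supp. scl B (coords x f) (gen f)) + (\<Sum>f\<in>supp. scl B (coords y f) (gen f))"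
      using coords_expand that by metis
    then show "x + y = (\<Sum>f\<in>supp. scl B ((coords x + coords y) f) (gen f))"
      by (simp add: vs.scale_left_distrib sum.distrib)
  qed (simp add: coords_def)
  show "coords (scl B c x) = fun_scale c (coords x)" if "x \<in> vec B" for c x
  proof (rule coords_eqI)
    show "scl B c x = (\<Sum>f\<in>supp. scl B (fun_scale c (coords x) f) (gen f))"
      by (subst coords_expand[OF that]) (simp add: fun_scale_def vs.scale_sum_right)
  qed (simp add: fun_scale_def coords_def)
qed

lemma coords_scale: "x \<in> vec B \<Longrightarrow> coords (scl B c x) = fun_scale c (coords x)"
  using coords_lin by (auto simp: lin_map_on_def)

lemma coords_sum:
  "(\<And>i. i \<in> I \<Longrightarrow> x i \<in> vec B) \<Longrightarrow> coords (\<Sum>i\<in>I. x i) = (\<Sum>i\<in>I. coords (x i))"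
  using lin_map_on_sum[OF coords_lin vs.vector_space_axioms subspace_vec] by blast

lemma scale_vec: "x \<in> vec B \<Longrightarrow> scl B c x \<in> vec B"
  by (rule vs.subspace_scale[OF subspace_vec])

lemma coords_bij: "bij_betw coords (vec B) {u. \<forall>x. x \<notin> supp \<longrightarrow> u x = 0}"
proof (rule bij_betwI[where g = "\<lambda>u. \<Sum>f\<in>supp. scl B (u f) (gen f)"])
  show "coords \<in> vec B \<rightarrow> {u. \<forall>x. x \<notin> supp \<longrightarrow> u x = 0}" by (auto simp: coords_def)
  show "(\<lambda>u. \<Sum>f\<in>supp. scl B (u f) (gen f)) \<in> {u. \<forall>x. x \<notin> supp \<longrightarrow> u x = 0} \<rightarrow> vec B"
    by (auto intro!: vs.subspace_sum[OF subspace_vec] scale_vec gen_vec)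
qed (auto simp: coords_expand[symmetric] intro: coords_eqI)

text \<open>The right-hand side is literally the action of \<open>twisted_group_alg\<close> on
  \<open>coords v\<close>, as \<open>coords_mul\<close> reproduces its product; so
  \<open>coords_iso\<close> only has to assemble the pieces.\<close>

lemma coords_act:
  assumes h: "h \<in> carrier K" and v: "v \<in> vec B"
  shows "coords (act B h v)
    = (\<Sum>f\<in>supp. fun_scale (coords v f * gen_act h f) (basis_elem (conjg K h f)))"
proof -
  have "act B h v = (\<Sum>f\<in>supp. scl B (coords v f * gen_act h f) (gen (conjg K h f)))"
    using h by (subst coords_expand[OF v]) (simp add: act_sum act_scale scale_vec gen_vec act_gen)
  then show ?thesis
    using h by (simp add: coords_sum coords_scale coords_gen scale_vec gen_vec supp_conjg)
qed

lemma coords_mul: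
  assumes a: "a \<in> vec B" and b: "b \<in> vec B"
  shows "coords (mul B a b) = (\<Sum>f\<in>supp. \<Sum>g\<in>supp.
    fun_scale (coords a f * coords b g * gen_mul f g) (basis_elem (f \<otimes> g)))"
proof -
  have "mul B a b = (\<Sum>f\<in>supp. mul B (scl B (coords a f) (gen f)) b)"
    by (subst coords_expand[OF a]) (simp add: mul_sum_left scale_vec gen_vec b)
  also have "\<dots> = (\<Sum>f\<in>supp. \<Sum>g\<in>supp.
      mul B (scl B (coords a f) (gen f)) (scl B (coords b g) (gen g)))"
    by (subst coords_expand[OF b]) (simp add: mul_sum_right scale_vec gen_vec)
  also have "\<dots> = (\<Sum>f\<in>supp. \<Sum>g\<in>supp.
      scl B (coords a f * coords b g * gen_mul f g) (gen (f \<otimes> g)))"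
    by (simp add: mul_scale_left mul_scale_right scale_vec gen_vec mul_gen supp_mult mult_ac)
  finally show ?thesis
    by (simp add: coords_sum coords_scale coords_gen scale_vec gen_vec supp_mult
        vs.subspace_sum[OF subspace_vec])
qed

lemma coords_homog:
  assumes "g \<in> carrier K" "v \<in> homog B g" "\<not> (x \<in> supp \<and> x = g)"
  shows "coords v x = 0"
  using assms homog_comp_homog[of v g x] supp_carrier coef_scale[of x 0] by (auto simp: coords_def)

lemma coords_iso: "z_alg_iso K B (twisted_group_alg K supp gen_mul gen_act) coords"
  unfolding z_alg_iso_def z_morphism_def
  using coords_lin coords_bij coords_homog coords_gen[OF one_supp]
  by (auto simp: twisted_group_alg_def coords_act coords_mul gen_one)

end

section \<open>Twisted group algebras\<close>

lemma vector_space_fun_scale: "vector_space (fun_scale :: 'k::field \<Rightarrow> ('g \<Rightarrow> 'k) \<Rightarrow> 'g \<Rightarrow> 'k)"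
  by unfold_locales (auto simp: fun_scale_def fun_eq_iff algebra_simps)

interpretation fs: vector_space "fun_scale :: 'k::field \<Rightarrow> ('g \<Rightarrow> 'k) \<Rightarrow> 'g \<Rightarrow> 'k"
  by (rule vector_space_fun_scale)

lemma sum_fun_apply: "(\<Sum>i\<in>I. f i) x = (\<Sum>i\<in>I. f i x)"
  by (induction I rule: infinite_finite_induct) auto

abbreviation single :: "'k::field \<Rightarrow> 'g \<Rightarrow> 'g \<Rightarrow> 'k" where
  "single c f \<equiv> fun_scale c (basis_elem f)"

lemma single_apply: "single c f x = (if x = f then c else 0)"
  by (simp add: fun_scale_def basis_elem_def)

locale twisted_group = finite_cocycle K \<alpha> for K (structure) and \<alpha> :: "'a \<Rightarrow> 'a \<Rightarrow> 'a \<Rightarrow> 'k::field" +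
  fixes F :: "'a set" and \<gamma> \<epsilon> :: "'a \<Rightarrow> 'a \<Rightarrow> 'k"
  assumes data: "twisted_group_data K \<alpha> F \<gamma> \<epsilon>"
begin

abbreviation A :: "('a, 'k, 'a \<Rightarrow> 'k) zalg" where
  "A \<equiv> twisted_group_alg K F \<gamma> \<epsilon>"

section \<open>Consequences of the conditions on \<open>F\<close>, \<open>\<gamma>\<close> and
  \<open>\<epsilon>\<close>\<close>

lemma normal_F: "F \<lhd> K"
  using data by (simp add: twisted_group_data_def)

lemma subgroup_F: "subgroup F K"
  using normal_F by (rule normal_imp_subgroup)

lemma F_carrier [simp]: "f \<in> F \<Longrightarrow> f \<in> carrier K"
  by (rule subgroup.mem_carrier[OF subgroup_F])

lemma one_F [simp]: "\<one> \<in> F"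
  using subgroup_F by (rule subgroup.one_closed)

lemma mult_F [simp]: "f \<in> F \<Longrightarrow> g \<in> F \<Longrightarrow> f \<otimes> g \<in> F"
  by (rule subgroup.m_closed[OF subgroup_F])

lemma inv_F [simp]: "f \<in> F \<Longrightarrow> inv f \<in> F"
  by (rule subgroup.m_inv_closed[OF subgroup_F])

lemma conjg_F [simp]: "h \<in> carrier K \<Longrightarrow> f \<in> F \<Longrightarrow> conjg K h f \<in> F"
  using normal_F by (simp add: conjg_def normal_inv_iff)

lemma conjg_F_iff: "h \<in> carrier K \<Longrightarrow> f \<in> carrier K \<Longrightarrow> conjg K h f \<in> F \<longleftrightarrow> f \<in> F"
  using conjg_F[of "inv h" "conjg K h f"] by auto

lemma finite_F [simp]: "finite F"
  by (rule finite_subset[OF _ fin]) auto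

lemma \<gamma>_nonzero: "f \<in> F \<Longrightarrow> g \<in> F \<Longrightarrow> \<gamma> f g \<noteq> 0"
  using data by (simp add: twisted_group_data_def normalised_2cochain_def)

lemma \<gamma>_one: "f \<in> F \<Longrightarrow> \<gamma> \<one> f = 1" "f \<in> F \<Longrightarrow> \<gamma> f \<one> = 1"
  using data by (simp_all add: twisted_group_data_def normalised_2cochain_def)

lemma \<gamma>_assoc:
  assumes "f \<in> F" "g \<in> F" "h \<in> F"
  shows "\<gamma> g h * \<gamma> f (g \<otimes> h) = \<alpha> f g h * (\<gamma> f g * \<gamma> (f \<otimes> g) h)"
proof -
  have "\<gamma> g h * inverse (\<gamma> (f \<otimes> g) h) * \<gamma> f (g \<otimes> h) * inverse (\<gamma> f g) = \<alpha> f g h"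
    using data assms by (simp add: twisted_group_data_def coboundary2_def)
  then show ?thesis using assms \<gamma>_nonzero[of "f \<otimes> g" h] \<gamma>_nonzero[of f g]
    by (auto simp: field_simps)
qed

lemma \<epsilon>_nonzero: "h \<in> carrier K \<Longrightarrow> f \<in> F \<Longrightarrow> \<epsilon> h f \<noteq> 0"
  using data by (simp add: twisted_group_data_def)

lemma \<epsilon>_mult:
  "g \<in> carrier K \<Longrightarrow> h \<in> carrier K \<Longrightarrow> f \<in> F \<Longrightarrow>
    \<epsilon> (g \<otimes> h) f = \<epsilon> g (conjg K h f) * \<epsilon> h f * act_cocycle K \<alpha> g h f"
  using data by (simp add: twisted_group_data_def)

lemma \<epsilon>_\<gamma>:
  "h \<in> carrier K \<Longrightarrow> f \<in> F \<Longrightarrow> g \<in> F \<Longrightarrow> \<gamma> f g * \<epsilon> h (f \<otimes> g)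
    = tensor_cocycle K \<alpha> h f g * \<epsilon> h f * \<epsilon> h g * \<gamma> (conjg K h f) (conjg K h g)"
  using data by (simp add: twisted_group_data_def)

text \<open>Multiplicativity of \<open>\<epsilon>\<close> at the pair of identities says that this
  nonzero value is its own square. It makes the unit invariant under the action.\<close>

lemma \<epsilon>_one: "h \<in> carrier K \<Longrightarrow> \<epsilon> h \<one> = 1"
  using \<epsilon>_\<gamma>[of h \<one> \<one>] \<epsilon>_nonzero[of h \<one>] \<gamma>_one by (simp add: tensor_cocycle_def)

section \<open>The space of the twisted group algebra, its action and its product\<close>

lemma scl_A [simp]: "scl A = fun_scale"
  and unt_A [simp]: "unt A = basis_elem \<one>"
  by (simp_all add: twisted_group_alg_def)

lemma vec_A: "vec A = {u. \<forall>x. x \<notin> F \<longrightarrow> u x = 0}"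
  by (simp add: twisted_group_alg_def)

lemma single_vec [simp]: "f \<in> F \<Longrightarrow> single c f \<in> vec A"
  by (auto simp: vec_A single_apply)

lemma single_homog: "f \<in> F \<Longrightarrow> single c f \<in> homog A f"
  by (auto simp: twisted_group_alg_def single_apply)

text \<open>Reduces every axiom about homogeneous elements to multiples of basis elements.\<close>

lemma homog_cases:
  assumes "u \<in> homog A g"
  obtains "u = 0" | c where "g \<in> F" "u = single c g"
proof (cases "g \<in> F")
  case True
  then have "u = single (u g) g" using assms by (auto simp: twisted_group_alg_def single_apply)
  then show ?thesis using that True by blast
next
  case False
  then have "u = 0" using assms by (auto simp: twisted_group_alg_def fun_eq_iff)
  then show ?thesis using that by blast
qed

lemma homog_nonzero: "u \<in> homog A g \<Longrightarrow> u \<noteq> 0 \<Longrightarrow> g \<in> F \<and> (\<exists>c. u = single c g)"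
  by (erule homog_cases) auto

lemma vec_outside: "u \<in> vec A \<Longrightarrow> x \<notin> carrier K \<Longrightarrow> u x = 0"
  unfolding vec_A using F_carrier by blast

lemma zero_homog: "0 \<in> homog A g"
  by (simp add: twisted_group_alg_def)

lemma vec_expand:
  assumes "u \<in> vec A"
  shows "(\<Sum>f\<in>F. single (u f) f) = u"
  using assms by (auto simp: fun_eq_iff sum_fun_apply single_apply vec_A)

text \<open>Agreement is tested on all scalar multiples of basis elements, so additivity replaces
  linearity and values in \<open>'k\<close> and in the function space are handled alike.\<close>

lemma additive_ext:
  fixes L M :: "('a \<Rightarrow> 'k) \<Rightarrow> 'c::ab_group_add"
  assumes L: "\<And>u v. L (u + v) = L u + L v" and M: "\<And>u v. M (u + v) = M u + M v"
    and LM: "\<And>c f. f \<in> F \<Longrightarrow> L (single c f) = M (single c f)" and u: "u \<in> vec A"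
  shows "L u = M u"
proof -
  have "L 0 = 0" "M 0 = 0" using L[of 0 0] M[of 0 0] by auto
  then have "L (sum g I) = (\<Sum>i\<in>I. L (g i))" "M (sum g I) = (\<Sum>i\<in>I. M (g i))"
    for g and I :: "'a set"
    by (induction I rule: infinite_finite_induct) (simp_all add: L M)
  then have "L (\<Sum>f\<in>F. single (u f) f) = M (\<Sum>f\<in>F. single (u f) f)" by (simp add: LM)
  then show ?thesis by (simp add: vec_expand u)
qed

text \<open>The action formula with free coefficients \<open>e\<close>. The freedom is needed to
  write the inverse of an action map in the same form.\<close>

definition monomial_map :: "'a \<Rightarrow> ('a \<Rightarrow> 'k) \<Rightarrow> ('a \<Rightarrow> 'k) \<Rightarrow> 'a \<Rightarrow> 'k" where
  "monomial_map h e u = (\<Sum>f\<in>F. single (u f * e f) (conjg K h f))"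

lemma act_A: "act A h = monomial_map h (\<epsilon> h)"
  by (simp add: twisted_group_alg_def monomial_map_def fun_eq_iff)

lemma monomial_map_add: "monomial_map h e (u + v) = monomial_map h e u + monomial_map h e v"
  by (simp add: monomial_map_def distrib_right fs.scale_left_distrib sum.distrib)

lemma monomial_map_scale: "monomial_map h e (fun_scale c u) = fun_scale c (monomial_map h e u)"
  by (simp add: monomial_map_def fs.scale_sum_right mult.assoc fun_scale_def[of c u])

lemma monomial_map_single:
  assumes "f \<in> F"
  shows "monomial_map h e (single c f) = single (c * e f) (conjg K h f)"
proof -
  have "monomial_map h e (single c f) = (\<Sum>g\<in>F. if g = f then single (c * e f) (conjg K h f) else 0)"
    unfolding monomial_map_def by (rule sum.cong) (auto simp: single_apply)
  then show ?thesis using assms by simp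
qed

lemma subspace_vec_A: "fs.subspace (vec A)"
  by (auto simp: fs.subspace_def vec_A fun_scale_def)

lemma monomial_map_vec: "h \<in> carrier K \<Longrightarrow> monomial_map h e u \<in> vec A"
  unfolding monomial_map_def by (intro fs.subspace_sum[OF subspace_vec_A]) simp

lemma monomial_map_inverse:
  assumes "h \<in> carrier K" "h' \<in> carrier K" "u \<in> vec A"
    and "\<And>f. f \<in> F \<Longrightarrow> conjg K h' (conjg K h f) = f"
    and "\<And>f. f \<in> F \<Longrightarrow> e f * e' (conjg K h f) = 1"
  shows "monomial_map h' e' (monomial_map h e u) = u"
proof (rule additive_ext[where L = "\<lambda>u. monomial_map h' e' (monomial_map h e u)" and M = "\<lambda>u. u"])
  show "monomial_map h' e' (monomial_map h e (single c f)) = single c f" if "f \<in> F" for c f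
    using assms that by (simp add: monomial_map_single mult.assoc)
qed (simp_all add: monomial_map_add assms)

lemma act_bij_A:
  assumes h: "h \<in> carrier K"
  shows "bij_betw (act A h) (vec A) (vec A)"
proof (rule bij_betwI)
  \<comment> \<open>The inverse of the map taking \<open>e_f\<close> to
    \<open>\<epsilon> h f\<close> times the basis element at \<open>conjg K h f\<close>. As the
    action is only projective, it differs in general from the action of
    \<open>inv h\<close>.\<close>
  let ?g = "monomial_map (inv h) (\<lambda>f. inverse (\<epsilon> h (conjg K (inv h) f)))"
  show "act A h \<in> vec A \<rightarrow> vec A" "?g \<in> vec A \<rightarrow> vec A"
    using h by (auto simp: act_A monomial_map_vec)
  show "?g (act A h u) = u" if "u \<in> vec A" for u
    unfolding act_A by (rule monomial_map_inverse) (use h that \<epsilon>_nonzero in auto)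
  show "act A h (?g u) = u" if "u \<in> vec A" for u
    unfolding act_A by (rule monomial_map_inverse) (use h that \<epsilon>_nonzero in auto)
qed

lemma mul_A: "mul A u v = (\<Sum>f\<in>F. \<Sum>g\<in>F. single (u f * v g * \<gamma> f g) (f \<otimes> g))"
  by (simp add: twisted_group_alg_def)

lemma mul_A_add:
  "mul A (u + v) w = mul A u w + mul A v w" "mul A w (u + v) = mul A w u + mul A w v"
  by (simp_all add: mul_A distrib_right distrib_left fs.scale_left_distrib sum.distrib)

lemma mul_A_scale:
  "mul A (fun_scale c u) w = fun_scale c (mul A u w)"
  "mul A w (fun_scale c u) = fun_scale c (mul A w u)"
  by (simp_all add: mul_A fs.scale_sum_right mult_ac fun_scale_def[of c u])

lemma mul_A_zero [simp]: "mul A 0 u = 0" "mul A u 0 = 0"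
  by (simp_all add: mul_A)

lemma mul_A_vec: "mul A u v \<in> vec A"
  unfolding mul_A by (intro fs.subspace_sum[OF subspace_vec_A]) simp

lemma mul_A_single:
  assumes "f \<in> F" "g \<in> F"
  shows "mul A (single c f) (single d g) = single (c * d * \<gamma> f g) (f \<otimes> g)"
proof -
  have "mul A (single c f) (single d g)
      = (\<Sum>x\<in>F. \<Sum>y\<in>F. if y = g then if x = f then single (c * d * \<gamma> f g) (f \<otimes> g) else 0 else 0)"
    unfolding mul_A by (intro sum.cong) (auto simp: single_apply)
  then show ?thesis using assms by simp
qed

lemma act_A_single: "f \<in> F \<Longrightarrow> act A h (single c f) = single (c * \<epsilon> h f) (conjg K h f)"
  by (simp add: act_A monomial_map_single)

lemma act_A_zero [simp]: "act A h 0 = 0"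
  by (simp add: act_A monomial_map_def)

section \<open>Object and algebra axioms for the twisted group algebra\<close>

lemma fin_dim_A: "fin_dim_space (scl A) (vec A)"
proof -
  have "fs.span (basis_elem ` F) = vec A"
  proof
    show "fs.span (basis_elem ` F) \<subseteq> vec A"
      using single_vec[where c = 1] by (intro fs.span_minimal subspace_vec_A) auto
    show "vec A \<subseteq> fs.span (basis_elem ` F)"
    proof
      fix u assume u: "u \<in> vec A"
      have "(\<Sum>f\<in>F. single (u f) f) \<in> fs.span (basis_elem ` F)"
        by (intro fs.span_sum fs.span_scale fs.span_base) auto
      then show "u \<in> fs.span (basis_elem ` F)" by (simp add: vec_expand u)
    qed
  qed
  then show ?thesis
    unfolding fin_dim_space_def using subspace_vec_A vector_space_fun_scale
    by (auto intro!: exI[of _ "basis_elem ` F"])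
qed

lemma homog_decomp_A: "u \<in> vec A \<Longrightarrow> \<exists>!p. homog_decomp K A u p"
proof (rule ex1I)
  assume u: "u \<in> vec A"
  let ?p = "\<lambda>g\<in>carrier K. single (u g) g"
  have "?p \<in> (\<Pi>\<^sub>E g\<in>carrier K. homog A g)"
    using u by (auto simp: twisted_group_alg_def single_apply)
  moreover have "u = (\<Sum>g\<in>carrier K. ?p g)"
    using u fin by (auto simp: fun_eq_iff sum_fun_apply single_apply vec_outside[OF u])
  ultimately show "homog_decomp K A u ?p" by (simp add: homog_decomp_def)
  fix q assume q: "homog_decomp K A u q"
  \<comment> \<open>Uniqueness: each \<open>q g\<close> is supported at \<open>g\<close>, so
    evaluating the sum at \<open>g\<close> isolates \<open>q g g\<close>.\<close>
  have q0: "q g x = 0" if "g \<in> carrier K" "x \<noteq> g" for g x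
    using q that by (auto simp: homog_decomp_def PiE_iff twisted_group_alg_def)
  have "u g = q g g" if "g \<in> carrier K" for g
  proof -
    have "u g = (\<Sum>x\<in>carrier K. q x g)"
      using q by (simp add: homog_decomp_def sum_fun_apply)
    also have "\<dots> = (\<Sum>x\<in>carrier K. if x = g then q g g else 0)"
      by (rule sum.cong) (auto simp: q0)
    finally show ?thesis using that fin by simp
  qed
  then have "q g = ?p g" if "g \<in> carrier K" for g
    using that q0 by (auto simp: fun_eq_iff single_apply)
  then show "q = ?p"
    using q
    by (intro extensionalityI[of q "carrier K"]) (auto simp: homog_decomp_def PiE_def)
qed

lemma act_homog_A:
  assumes "f \<in> carrier K" "g \<in> carrier K"
  shows "act A f ` homog A g = homog A (conjg K f g)"
proof (intro subset_antisym subsetI)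
  fix v assume "v \<in> act A f ` homog A g"
  then show "v \<in> homog A (conjg K f g)"
    using assms by (auto elim!: homog_cases simp: act_A_single single_homog zero_homog)
next
  fix v assume v: "v \<in> homog A (conjg K f g)"
  then show "v \<in> act A f ` homog A g"
  proof (cases rule: homog_cases)
    case 1
    then show ?thesis using zero_homog by (force intro!: image_eqI[of _ _ 0])
  next
    case (2 c)
    \<comment> \<open>Normality brings the degree back into \<open>F\<close>; dividing by the
      nonzero \<open>\<epsilon> f g\<close> then produces the preimage.\<close>
    then have "g \<in> F" using assms by (simp add: conjg_F_iff)
    then show ?thesis
      using 2 assms \<epsilon>_nonzero
      by (intro image_eqI[of _ _ "single (c / \<epsilon> f g) g"]) (simp_all add: act_A_single single_homog)
  qed
qed

text \<open>On a basis element this is the first compatibility condition,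
  \<open>\<epsilon>_mult\<close>.\<close>

lemma act_mult_A:
  assumes "f \<in> carrier K" "g \<in> carrier K" "h \<in> carrier K" "v \<in> homog A h"
  shows "act A (f \<otimes> g) v = fun_scale (act_cocycle K \<alpha> f g h) (act A f (act A g v))"
  using assms(4)
  by (rule homog_cases) (use assms in \<open>simp_all add: act_A_single \<epsilon>_mult conjg_mult mult_ac\<close>)

lemma z_object_A: "z_object K \<alpha> A"
  unfolding z_object_def
proof (intro conjI ballI fin_dim_A homog_decomp_A act_bij_A act_homog_A)
  fix g assume "g \<in> carrier K"
  show "module.subspace (scl A) (homog A g)"
    by (auto simp: fs.subspace_def twisted_group_alg_def fun_scale_def)
  show "homog A g \<subseteq> vec A" by (auto simp: twisted_group_alg_def)
next
  fix f assume "f \<in> carrier K"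
  then show "lin_map_on (scl A) (vec A) (scl A) (vec A) (act A f)"
    by (auto simp: lin_map_on_def act_A monomial_map_vec monomial_map_add monomial_map_scale)
qed (simp_all add: act_mult_A)

text \<open>On basis elements, commuting with the action is the second compatibility condition,
  \<open>\<epsilon>_\<gamma>\<close>, and \<open>conjg_hom\<close> matches the degrees.\<close>

lemma z_bimorphism_A: "z_bimorphism K \<alpha> A A A (mul A)"
  unfolding z_bimorphism_def
proof (intro conjI ballI)
  fix g h x y assume gh: "g \<in> carrier K" "h \<in> carrier K" and x: "x \<in> homog A g" and y: "y \<in> homog A h"
  show "mul A x y \<in> homog A (g \<otimes> h)"
    using x y by (auto elim!: homog_cases simp: mul_A_single single_homog zero_homog)
  fix f assume f: "f \<in> carrier K"
  show "act A f (mul A x y)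
      = scl A (tensor_cocycle K \<alpha> f g h) (mul A (act A f x) (act A f y))"
  proof (cases "x = 0 \<or> y = 0")
    case True
    then show ?thesis by auto
  next
    case False
    then obtain c d where *: "g \<in> F" "x = single c g" "h \<in> F" "y = single d h"
      using x y homog_nonzero[of x g] homog_nonzero[of y h] by blast
    have "c * d * \<gamma> g h * \<epsilon> f (g \<otimes> h) = c * d * (\<gamma> g h * \<epsilon> f (g \<otimes> h))" by simp
    also have "\<dots> = tensor_cocycle K \<alpha> f g h
        * (c * \<epsilon> f g * (d * \<epsilon> f h) * \<gamma> (conjg K f g) (conjg K f h))"
      unfolding \<epsilon>_\<gamma>[OF f *(1,3)] by (simp only: mult_ac)
    finally show ?thesis
      using * f by (simp add: mul_A_single act_A_single conjg_hom)
  qed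
qed (auto simp: lin_map_on_def mul_A_vec mul_A_add mul_A_scale)

text \<open>On basis elements this is \<open>d(\<gamma>) = \<alpha>\<close> in the form
  \<open>\<gamma>_assoc\<close>.\<close>

lemma mul_assoc_A:
  assumes "a \<in> homog A f" "b \<in> homog A g" "c \<in> homog A h"
  shows "mul A a (mul A b c) = fun_scale (\<alpha> f g h) (mul A (mul A a b) c)"
proof (cases "a = 0 \<or> b = 0 \<or> c = 0")
  case True
  then show ?thesis by auto
next
  case False
  then have nz: "a \<noteq> 0" "b \<noteq> 0" "c \<noteq> 0" by auto
  obtain x y z where *: "f \<in> F" "a = single x f" "g \<in> F" "b = single y g" "h \<in> F" "c = single z h"
    using homog_nonzero[OF assms(1) nz(1)] homog_nonzero[OF assms(2) nz(2)]
      homog_nonzero[OF assms(3) nz(3)] by blast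
  have "x * (y * z * \<gamma> g h) * \<gamma> f (g \<otimes> h) = x * y * z * (\<gamma> g h * \<gamma> f (g \<otimes> h))"
    by (simp add: mult_ac)
  also have "\<dots> = \<alpha> f g h * (x * y * \<gamma> f g * z * \<gamma> (f \<otimes> g) h)"
    unfolding \<gamma>_assoc[OF *(1,3,5)] by (simp add: mult_ac)
  finally show ?thesis using * by (simp add: mul_A_single m_assoc)
qed

lemma mul_unt_A:
  assumes "u \<in> vec A"
  shows "mul A (basis_elem \<one>) u = u" "mul A u (basis_elem \<one>) = u"
proof -
  have "mul A (single 1 \<one>) u = u"
    by (rule additive_ext[where L = "mul A (single 1 \<one>)" and M = "\<lambda>u. u"])
       (use assms in \<open>simp_all add: mul_A_add mul_A_single \<gamma>_one del: fs.scale_one\<close>)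
  then show "mul A (basis_elem \<one>) u = u" by simp
  have "mul A u (single 1 \<one>) = u"
    by (rule additive_ext[where L = "\<lambda>u. mul A u (single 1 \<one>)" and M = "\<lambda>u. u"])
       (use assms in \<open>simp_all add: mul_A_add mul_A_single \<gamma>_one del: fs.scale_one\<close>)
  then show "mul A u (basis_elem \<one>) = u" by simp
qed

lemma z_algebra_A: "z_algebra K \<alpha> A"
  unfolding z_algebra_def
proof (intro conjI ballI z_object_A z_bimorphism_A)
  show "unt A \<in> homog A \<one>" using single_homog[of \<one> 1] by simp
  show "act A g (unt A) = unt A" if "g \<in> carrier K" for g
    using act_A_single[of \<one> g 1] that by (simp add: \<epsilon>_one)
qed (simp_all add: mul_assoc_A mul_unt_A)

sublocale A: graded_algebra K \<alpha> A
  by unfold_locales (rule z_algebra_A)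

section \<open>Commutativity, indecomposability and separability\<close>

lemma commutative_A:
  assumes comm: "\<And>f g. f \<in> F \<Longrightarrow> g \<in> F \<Longrightarrow> \<gamma> f g = \<epsilon> f g * \<gamma> (conjg K f g) f"
  shows "z_commutative K A"
  unfolding z_commutative_def
proof (intro ballI)
  fix f a b assume f: "f \<in> carrier K" and a: "a \<in> homog A f" and b: "b \<in> vec A"
  from a show "mul A a b = mul A (act A f b) a"
  proof (cases rule: homog_cases)
    case (2 c)
    \<comment> \<open>For nonzero \<open>a\<close> the degree \<open>f\<close> lies in
      \<open>F\<close>. Both sides are additive in \<open>b\<close>, so \<open>b\<close> may be a
      multiple of a basis element; the two products share the degree \<open>fg\<close>, and
      \<open>comm\<close> equates their coefficients.\<close>
    show ?thesis
    proof (rule additive_ext[where L = "mul A a" and M = "\<lambda>u. mul A (act A f u) a", OF _ _ _ b])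
      fix d g assume g: "g \<in> F"
      have "conjg K f g \<otimes> f = f \<otimes> g" using f g by (simp add: conjg_def m_assoc)
      moreover have "c * d * \<gamma> f g = d * \<epsilon> f g * c * \<gamma> (conjg K f g) f"
        unfolding comm[OF 2(1) g] by (simp only: mult_ac)
      ultimately show "mul A a (single d g) = mul A (act A f (single d g)) a"
        using 2 f g by (simp add: act_A_single mul_A_single)
    qed (simp_all add: mul_A_add act_A monomial_map_add)
  qed simp
qed

lemma indecomposable_A: "z_indecomposable K \<alpha> A"
proof (rule A.indecomposableI, rule subsetI)
  fix u assume "u \<in> homog A \<one>"
  then show "u \<in> range (\<lambda>c. scl A c (unt A))"
  proof (cases rule: homog_cases)
    case 1
    then have "u = scl A 0 (unt A)" by simp
    then show ?thesis by blast
  next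
    case (2 c)
    then have "u = scl A c (unt A)" by simp
    then show ?thesis by blast
  qed
qed

lemma homog_comp_one_A:
  assumes "v \<in> vec A"
  shows "homog_comp K A \<one> v = fun_scale (v \<one>) (basis_elem \<one>)"
  by (rule A.homog_comp_unique[where q = "\<lambda>g. single (v g) g"])
     (use assms fin in \<open>auto simp: twisted_group_alg_def single_apply fun_eq_iff sum_fun_apply vec_outside[OF assms]\<close>)

lemma trace_A: "v \<in> vec A \<Longrightarrow> trace_fun K A v = of_nat (fs.dim (vec A)) * v \<one>"
  using A.trace_fun_scalar[of v "v \<one>"] homog_comp_one_A[of v] by simp

text \<open>Multiplication by a basis element permutes the coefficients up to nonzero factors:
  cancellation in the group leaves a single contribution at the given place.\<close>

lemma mul_single_apply:
  assumes "u \<in> vec A" "f \<in> F" "g \<in> F"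
  shows "mul A u (single 1 g) (f \<otimes> g) = u f * \<gamma> f g" "mul A (single 1 g) u (g \<otimes> f) = \<gamma> g f * u f"
proof -
  show "mul A u (single 1 g) (f \<otimes> g) = u f * \<gamma> f g"
    by (rule additive_ext[where L = "\<lambda>u. mul A u (single 1 g) (f \<otimes> g)"
          and M = "\<lambda>u. u f * \<gamma> f g"])
       (use assms in \<open>auto simp: mul_A_add mul_A_single single_apply distrib_right
          simp del: fs.scale_one\<close>)
  show "mul A (single 1 g) u (g \<otimes> f) = \<gamma> g f * u f"
    by (rule additive_ext[where L = "\<lambda>u. mul A (single 1 g) u (g \<otimes> f)"
          and M = "\<lambda>u. \<gamma> g f * u f"])
       (use assms in \<open>auto simp: mul_A_add mul_A_single single_apply distrib_left
          simp del: fs.scale_one\<close>)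
qed

text \<open>If \<open>a\<close> has a nonzero coefficient at \<open>f\<close>, the basis element at
  \<open>inv f\<close> detects it from both sides, since the trace is \<open>dim\<close> times the
  coefficient at \<open>\<one>\<close>.\<close>

lemma separable_A:
  assumes dim: "of_nat (fs.dim (vec A)) \<noteq> (0 :: 'k)"
  shows "z_separable K A"
proof -
  have "\<exists>b\<in>vec A. trace_fun K A (mul A a b) \<noteq> 0 \<and> trace_fun K A (mul A b a) \<noteq> 0"
    if a: "a \<in> vec A" "a \<noteq> 0" for a
  proof -
    obtain f where f: "a f \<noteq> 0" using a by (auto simp: fun_eq_iff)
    then have fF: "f \<in> F" using a by (auto simp: vec_A)
    have "mul A a (single 1 (inv f)) \<one> \<noteq> 0" "mul A (single 1 (inv f)) a \<one> \<noteq> 0"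
      using mul_single_apply[OF a(1) fF, of "inv f"] fF f \<gamma>_nonzero by simp_all
    then show ?thesis
      using fF dim
      by (intro bexI[of _ "single 1 (inv f)"])
         (auto simp: trace_A mul_A_vec simp del: fs.scale_one)
  qed
  then show ?thesis unfolding z_separable_def by blast
qed

end

section \<open>Restriction of the cocycle to a subgroup, and the theorem\<close>

lemma (in finite_cocycle) subgroup_finite_cocycle:
  assumes H: "subgroup H K"
  shows "finite_cocycle (K\<lparr>carrier := H\<rparr>) \<alpha>"
proof -
  interpret H: group "K\<lparr>carrier := H\<rparr>" by (rule subgroup_imp_group[OF H])
  have HK: "H \<subseteq> carrier K" by (rule subgroup.subset[OF H])
  show ?thesis
  proof
    show "finite (carrier (K\<lparr>carrier := H\<rparr>))" using finite_subset[OF HK fin] by simp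
    show "normalised_3cocycle (K\<lparr>carrier := H\<rparr>) \<alpha>"
      using cocycle HK unfolding normalised_3cocycle_def by (simp add: subset_iff)
  qed
qed

text \<open>Over the group \<open>H\<close>, the first half takes \<open>supp\<close>,
  \<open>gen_mul\<close> and \<open>gen_act\<close> as \<open>F\<close>, \<open>\<gamma>\<close> and
  \<open>\<epsilon>\<close>, with \<open>coords\<close> as the isomorphism; the second half collects
  the properties of the twisted group algebra.\<close>

theorem proposition3p15:
  fixes G :: "('g, 'm) monoid_scheme"
    and H :: "'g set"
    and \<alpha> :: "'g \<Rightarrow> 'g \<Rightarrow> 'g \<Rightarrow> 'k::{alg_closed_field, field_char_0}"
  assumes "group G" and "finite (carrier G)" and "subgroup H G"
    and "normalised_3cocycle G \<alpha>"
  shows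
    "(\<forall>B :: ('g, 'k, 'b::ab_group_add) zalg.
        z_algebra (G\<lparr>carrier := H\<rparr>) \<alpha> B \<and>
        z_indecomposable (G\<lparr>carrier := H\<rparr>) \<alpha> B \<and>
        z_separable (G\<lparr>carrier := H\<rparr>) B \<and>
        trivial_component (G\<lparr>carrier := H\<rparr>) B \<longrightarrow>
        (\<exists>F \<gamma> \<epsilon>.
           twisted_group_data (G\<lparr>carrier := H\<rparr>) \<alpha> F \<gamma> \<epsilon> \<and>
           z_alg_isomorphic (G\<lparr>carrier := H\<rparr>) B
             (twisted_group_alg (G\<lparr>carrier := H\<rparr>) F \<gamma> \<epsilon>))) \<and>
     (\<forall>F \<gamma> \<epsilon>.
        twisted_group_data (G\<lparr>carrier := H\<rparr>) \<alpha> F \<gamma> \<epsilon> \<and>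
        (\<forall>f\<in>F. \<forall>g\<in>F. \<gamma> f g = \<epsilon> f g * \<gamma> (f \<otimes>\<^bsub>G\<^esub> g \<otimes>\<^bsub>G\<^esub> inv\<^bsub>G\<^esub> f) f) \<longrightarrow>
        z_commutative (G\<lparr>carrier := H\<rparr>)
          (twisted_group_alg (G\<lparr>carrier := H\<rparr>) F \<gamma> \<epsilon>) \<and>
        z_etale (G\<lparr>carrier := H\<rparr>) \<alpha>
          (twisted_group_alg (G\<lparr>carrier := H\<rparr>) F \<gamma> \<epsilon>))"
proof -
  let ?K = "G\<lparr>carrier := H\<rparr>"
  interpret G: finite_cocycle G \<alpha>
    by (intro finite_cocycle.intro finite_cocycle_axioms.intro assms)
  interpret K: finite_cocycle ?K \<alpha> by (rule G.subgroup_finite_cocycle) fact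
  show ?thesis
  proof (intro conjI[of "All _" "All _"] allI impI)
    fix B :: "('g, 'k, 'b) zalg"
    assume "z_algebra ?K \<alpha> B \<and> z_indecomposable ?K \<alpha> B \<and> z_separable ?K B \<and>
      trivial_component ?K B"
    then interpret separable_trivial_algebra ?K \<alpha> B by unfold_locales auto
    show "\<exists>F \<gamma> \<epsilon>. twisted_group_data ?K \<alpha> F \<gamma> \<epsilon> \<and>
        z_alg_isomorphic ?K B (twisted_group_alg ?K F \<gamma> \<epsilon>)"
      using twisted_group_data_supp coords_iso unfolding z_alg_isomorphic_def by blast
  next
    fix F \<gamma> \<epsilon>
    assume *: "twisted_group_data ?K \<alpha> F \<gamma> \<epsilon> \<and>
      (\<forall>f\<in>F. \<forall>g\<in>F. \<gamma> f g = \<epsilon> f g * \<gamma> (f \<otimes>\<^bsub>G\<^esub> g \<otimes>\<^bsub>G\<^esub> inv\<^bsub>G\<^esub> f) f)"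
    then interpret twisted_group ?K \<alpha> F \<gamma> \<epsilon> by unfold_locales blast
    \<comment> \<open>Inverses in the subgroup agree with those in \<open>G\<close>, so the stated
      condition is the one required over \<open>H\<close>.\<close>
    have "conjg ?K f g = f \<otimes>\<^bsub>G\<^esub> g \<otimes>\<^bsub>G\<^esub> inv\<^bsub>G\<^esub> f" if "f \<in> F" for f g
      using F_carrier[OF that] G.m_inv_consistent[OF \<open>subgroup H G\<close>] by (simp add: conjg_def)
    then have comm: "z_commutative ?K A"
      using * by (intro commutative_A) simp
    \<comment> \<open>The nonzero unit makes the dimension positive, hence nonzero in the field of
      characteristic zero, as \<open>separable_A\<close> demands.\<close>
    have "basis_elem \<one>\<^bsub>G\<^esub> \<in> vec A" "basis_elem \<one>\<^bsub>G\<^esub> \<noteq> (0 :: 'g \<Rightarrow> 'k)"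
      using A.unt_vec by (auto simp: basis_elem_def fun_eq_iff)
    then have "vec A \<noteq> {0}" by auto
    then have "fs.dim (vec A) > 0" using fin_dim_space_dim_pos[OF fin_dim_A] by simp
    then have "z_separable ?K A" by (intro separable_A) simp
    then show "z_commutative ?K A \<and> z_etale ?K \<alpha> A"
      using comm by (simp add: z_etale_def z_algebra_A indecomposable_A)
  qed
qed

end
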